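(* Let $a>0$, $b>0$, and let $(\mu_n)_n$ be a Cauchy sequence in $(\mathcal{M}^s(\mathbb{R}^d),\|\cdot\|^{a,b})$. If $(\mu_n)_n$ is tight and has uniformly bounded mass, then it converges in $(\mathcal{M}^s(\mathbb{R}^d),\|\cdot\|^{a,b})$.
   Context: $\mathcal{M}(\mathbb{R}^d)$ is the set of positive Borel (Radon) measures on $\mathbb{R}^d$ with finite mass; $\mathcal{M}^s(\mathbb{R}^d)$ is the vector space of signed measures $\mu=\mu_+-\mu_-$ with $\mu_\pm\in\mathcal{M}(\mathbb{R}^d)$; $|\mu|$ denotes the total mass (total variation) of $\mu$; uniformly bounded mass means $\sup_n|\mu_n|<\infty$. A sequence $(\mu_n)$ in $\mathcal{M}(\mathbb{R}^d)$ is tight if for each $\varepsilon>0$ there is a compact $K\subset\mathbb{R}^d$ with $\mu_n(\mathbb{R}^d\setminus K)<\varepsilon$ for all $n$. A sequence in $\mathcal{M}^s(\mathbb{R}^d)$ is tight if the sequences $(\mu_n^+)$ and $(\mu_n^-)$ given by the Jordan decompositions are both tight. For $\tilde\mu,\tilde\nu\in\mathcal{M}(\mathbb{R}^d)$ of equal mass, $W_1(\tilde\mu,\tilde\nu)=\min_{\pi}\int|x-y|\,d\pi(x,y)$ over positive measures $\pi$ on $\mathbb{R}^d\times\mathbb{R}^d$ with marginals $\tilde\mu,\tilde\nu$. For $\mu,\nu\in\mathcal{M}(\mathbb{R}^d)$, $$W_1^{a,b}(\mu,\nu)=\inf\{a(|\mu-\tilde\mu|+|\nu-\tilde\nu|)+bW_1(\tilde\mu,\tilde\nu):\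 \tilde\mu,\tilde\nu\in\mathcal{M}(\mathbb{R}^d),\ |\tilde\mu|=|\tilde\nu|\}.$$ For $\mu\in\mathcal{M}^s(\mathbb{R}^d)$, $\|\mu\|^{a,b}=W_1^{a,b}(\mu_+,\mu_-)$, where $\mu=\mu_+-\mu_-$ is any decomposition with $\mu_\pm\in\mathcal{M}(\mathbb{R}^d)$ (the value does not depend on the decomposition). *)

theory Defs
  imports "HOL-Analysis.Analysis"
begin

text \<open>Finite Borel measures on a Euclidean space are automatically Radon.\<close>

definition pos_measures :: "'a::euclidean_space measure set" where
  "pos_measures = {M. sets M = sets borel \<and> finite_measure M}"

text \<open>
  A signed measure is represented by its set function; addition and subtraction are the pointwise
  ones. Since the library's \<^const>\<open>measure\<close> is 0 on non-measurable sets, equality of two such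
  functions is equality on Borel sets.
\<close>

definition decomposition ::
    "('a::euclidean_space set \<Rightarrow> real) \<Rightarrow> 'a measure \<Rightarrow> 'a measure \<Rightarrow> bool" where
  "decomposition \<mu> P N \<longleftrightarrow>
     P \<in> pos_measures \<and> N \<in> pos_measures \<and> \<mu> = measure P - measure N"

definition signed_measures :: "('a::euclidean_space set \<Rightarrow> real) set" where
  "signed_measures = {\<mu>. \<exists>P N. decomposition \<mu> P N}"

definition jordan_decomposition ::
    "('a::euclidean_space set \<Rightarrow> real) \<Rightarrow> 'a measure \<Rightarrow> 'a measure \<Rightarrow> bool" where
  "jordan_decomposition \<mu> P N \<longleftrightarrow>
     decomposition \<mu> P N \<and> (\<exists>S\<in>sets borel. measure P (- S) = 0 \<and> measure N S = 0)"

definition pos_part :: "('a::euclidean_space set \<Rightarrow> real) \<Rightarrow> 'a measure" where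
  "pos_part \<mu> = (THE P. \<exists>N. jordan_decomposition \<mu> P N)"

definition neg_part :: "('a::euclidean_space set \<Rightarrow> real) \<Rightarrow> 'a measure" where
  "neg_part \<mu> = (THE N. \<exists>P. jordan_decomposition \<mu> P N)"

definition total_mass :: "('a::euclidean_space set \<Rightarrow> real) \<Rightarrow> real" where
  "total_mass \<mu> = measure (pos_part \<mu>) UNIV + measure (neg_part \<mu>) UNIV"

definition tight_pos :: "(nat \<Rightarrow> 'a::euclidean_space measure) \<Rightarrow> bool" where
  "tight_pos M \<longleftrightarrow>
     (\<forall>\<epsilon>>0. \<exists>K. compact K \<and> (\<forall>n. measure (M n) (UNIV - K) < \<epsilon>))"

definition tight_signed :: "(nat \<Rightarrow> 'a::euclidean_space set \<Rightarrow> real) \<Rightarrow> bool" where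
  "tight_signed \<mu> \<longleftrightarrow> tight_pos (\<lambda>n. pos_part (\<mu> n)) \<and> tight_pos (\<lambda>n. neg_part (\<mu> n))"

definition couplings ::
    "'a::euclidean_space measure \<Rightarrow> 'a measure \<Rightarrow> ('a \<times> 'a) measure set" where
  "couplings M N =
     {\<pi>. sets \<pi> = sets borel \<and> distr \<pi> borel fst = M \<and> distr \<pi> borel snd = N}"

text \<open>Without first moments the transport cost may be infinite, hence the extended value.\<close>

definition W1 :: "'a::euclidean_space measure \<Rightarrow> 'a measure \<Rightarrow> ennreal" where
  "W1 M N = (INF \<pi>\<in>couplings M N. \<integral>\<^sup>+ z. ennreal (norm (fst z - snd z)) \<partial>\<pi>)"

definition W1ab ::
    "real \<Rightarrow> real \<Rightarrow> 'a::euclidean_space measure \<Rightarrow> 'a measure \<Rightarrow> ennreal" where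
  "W1ab a b M N =
     (INF (M', N') \<in> {(M', N'). M' \<in> pos_measures \<and> N' \<in> pos_measures \<and>
                                 measure M' UNIV = measure N' UNIV}.
        ennreal (a * (total_mass (measure M - measure M') + total_mass (measure N - measure N')))
        + ennreal b * W1 M' N')"

text \<open>
  The norm is evaluated at an arbitrary decomposition (its value does not depend on the choice).
  The conversion to a real number loses nothing, see \<open>W1ab_finite\<close> below.
\<close>

definition norm_ab :: "real \<Rightarrow> real \<Rightarrow> ('a::euclidean_space set \<Rightarrow> real) \<Rightarrow> real" where
  "norm_ab a b \<mu> =
     (let (P, N) = (SOME (P, N). decomposition \<mu> P N) in enn2real (W1ab a b P N))"


lemma W1_null: "W1 (null_measure borel) (null_measure borel :: 'a::euclidean_space measure) = 0"
proof -
  let ?\<pi> = "null_measure borel :: ('a \<times> 'a) measure"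
  have f: "fst \<in> ?\<pi> \<rightarrow>\<^sub>M (borel :: 'a measure)" and s: "snd \<in> ?\<pi> \<rightarrow>\<^sub>M (borel :: 'a measure)"
    using borel_measurable_continuous_onI[OF continuous_on_fst[OF continuous_on_id]]
      borel_measurable_continuous_onI[OF continuous_on_snd[OF continuous_on_id]]
    by (auto simp: measurable_def)
  have "?\<pi> \<in> couplings (null_measure borel) (null_measure borel)"
    unfolding couplings_def using f s
    by (auto intro!: measure_eqI simp: emeasure_distr)
  moreover have "(\<integral>\<^sup>+ z. ennreal (norm (fst z - snd z)) \<partial>?\<pi>) = 0"
    by (subst nn_integral_null_measure) auto
  ultimately show ?thesis
    unfolding W1_def by (metis (no_types, lifting) INF_lower le_zero_eq)
qed

lemma W1ab_finite: "W1ab a b M N < \<infinity>"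
proof -
  let ?z = "null_measure borel :: 'a measure"
  have z: "?z \<in> pos_measures"
    by (auto simp: pos_measures_def intro!: finite_measureI)
  have "W1ab a b M N \<le>
      ennreal (a * (total_mass (measure M - measure ?z) + total_mass (measure N - measure ?z)))
      + ennreal b * W1 ?z ?z"
    unfolding W1ab_def using z by (intro INF_lower2[of "(?z, ?z)"]) auto
  also have "\<dots> < \<infinity>"
    by (simp add: W1_null)
  finally show ?thesis .
qed

lemma jordan_decomposition_exists:
  fixes \<mu> :: "'a::euclidean_space set \<Rightarrow> real"
  assumes "\<mu> \<in> signed_measures"
  shows "\<exists>P N. jordan_decomposition \<mu> P N"
proof -
  obtain M N where d: "decomposition \<mu> M N"
    using assms by (auto simp: signed_measures_def)
  then have sM: "sets M = sets borel" and sN: "sets N = sets borel"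
    and fM: "finite_measure M" and fN: "finite_measure N"
    and \<mu>: "\<mu> = measure M - measure N"
    by (auto simp: decomposition_def pos_measures_def)
  interpret M: finite_measure M by fact
  interpret N: finite_measure N by fact
  obtain Y where Y: "Y \<in> sets borel"
    and Y1: "\<And>X. X \<in> sets borel \<Longrightarrow> X \<subseteq> Y \<Longrightarrow> emeasure N X \<le> emeasure M X"
    and Y2: "\<And>X. X \<in> sets borel \<Longrightarrow> X \<inter> Y = {} \<Longrightarrow> emeasure M X \<le> emeasure N X"
    using finite_unsigned_Hahn_decomposition[OF fM fN] sM sN by auto
  have diff: "\<exists>P. P \<in> pos_measures \<and> (\<forall>A\<in>sets borel. measure P A = measure K (A \<inter> Z) - measure L (A \<inter> Z))"
    if K: "sets K = sets borel" "finite_measure K" and L: "sets L = sets borel" "finite_measure L"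
      and Z: "Z \<in> sets borel"
      and le: "\<And>X. X \<in> sets borel \<Longrightarrow> X \<subseteq> Z \<Longrightarrow> emeasure L X \<le> emeasure K X"
    for K L :: "'a measure" and Z
  proof -
    interpret K: finite_measure K by fact
    interpret L: finite_measure L by fact
    let ?K = "density K (indicator Z)" and ?L = "density L (indicator Z)"
    have eK: "emeasure ?K A = emeasure K (A \<inter> Z)" if "A \<in> sets borel" for A
      using that Z K by (subst emeasure_density) (auto simp flip: indicator_inter_arith simp: Int_commute)
    have eL: "emeasure ?L A = emeasure L (A \<inter> Z)" if "A \<in> sets borel" for A
      using that Z L by (subst emeasure_density) (auto simp flip: indicator_inter_arith simp: Int_commute)
    have spK: "space K = UNIV" and spL: "space L = UNIV"
      using sets_eq_imp_space_eq[OF K(1)] sets_eq_imp_space_eq[OF L(1)] by auto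
    have fK: "finite_measure ?K" and fL: "finite_measure ?L"
      using eK[of UNIV] eL[of UNIV] spK spL by (auto intro!: finite_measureI)
    let ?P = "diff_measure ?K ?L"
    have eP: "emeasure ?P A = emeasure K (A \<inter> Z) - emeasure L (A \<inter> Z)" if "A \<in> sets borel" for A
      using fK fL K L that Z le by (subst emeasure_diff_measure) (auto simp: eK eL)
    have "finite_measure ?P"
      using eP[of UNIV] spK by (auto intro!: finite_measureI)
    moreover have "measure ?P A = measure K (A \<inter> Z) - measure L (A \<inter> Z)" if "A \<in> sets borel" for A
    proof -
      have "emeasure L (A \<inter> Z) \<le> emeasure K (A \<inter> Z)" using that Z by (intro le) auto
      then have "measure L (A \<inter> Z) \<le> measure K (A \<inter> Z)"
        by (simp add: K.emeasure_eq_measure L.emeasure_eq_measure)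
      then show ?thesis
        using eP[OF that]
        by (simp add: measure_def[of ?P] K.emeasure_eq_measure L.emeasure_eq_measure
            ennreal_minus)
    qed
    moreover have "sets ?P = sets borel" using K by simp
    ultimately show ?thesis unfolding pos_measures_def by blast
  qed
  obtain P where P: "P \<in> pos_measures"
    "\<And>A. A \<in> sets borel \<Longrightarrow> measure P A = measure M (A \<inter> Y) - measure N (A \<inter> Y)"
    using diff[OF sM fM sN fN Y Y1] by blast
  obtain Q where Q: "Q \<in> pos_measures"
    "\<And>A. A \<in> sets borel \<Longrightarrow> measure Q A = measure N (A \<inter> - Y) - measure M (A \<inter> - Y)"
    using diff[OF sN fN sM fM borel_comp[OF Y]] Y2 by (metis disjoint_eq_subset_Compl)
  have "\<mu> A = measure P A - measure Q A" for A
  proof (cases "A \<in> sets borel")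
    case True
    have "measure M A = measure M (A \<inter> Y) + measure M (A \<inter> - Y)"
      using True Y sM by (subst M.finite_measure_Union[symmetric]) (auto intro!: arg_cong[where f="measure M"])
    moreover have "measure N A = measure N (A \<inter> Y) + measure N (A \<inter> - Y)"
      using True Y sN by (subst N.finite_measure_Union[symmetric]) (auto intro!: arg_cong[where f="measure N"])
    ultimately show ?thesis using True by (simp add: \<mu> P Q)
  next
    case False
    then show ?thesis
      using P(1) Q(1) sM sN by (simp add: \<mu> pos_measures_def measure_notin_sets)
  qed
  then have "decomposition \<mu> P Q" using P Q by (auto simp: decomposition_def)
  moreover have "measure P (- Y) = 0" "measure Q Y = 0" using Y by (simp_all add: P Q)
  ultimately show ?thesis using Y unfolding jordan_decomposition_def by blast
qed

lemma jordan_decomposition_unique: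
  assumes "jordan_decomposition \<mu> P N" "jordan_decomposition \<mu> P' N'"
  shows "P = P' \<and> N = N'"
proof -
  have le: "measure P A \<le> measure P' A"
    if j: "jordan_decomposition \<mu> P N" "jordan_decomposition \<mu> P' N'" and A: "A \<in> sets borel"
    for P N P' N' A
  proof -
    obtain S where S: "S \<in> sets borel" "measure P (- S) = 0" "measure N S = 0"
      using j by (auto simp: jordan_decomposition_def)
    have s: "sets P = sets borel" "sets N = sets borel" "sets P' = sets borel"
      and f: "finite_measure P" "finite_measure N" "finite_measure P'"
      and m: "\<mu> = measure P - measure N" "\<mu> = measure P' - measure N'"
      using j by (auto simp: jordan_decomposition_def decomposition_def pos_measures_def)
    interpret P: finite_measure P by fact
    interpret N: finite_measure N by fact
    interpret P': finite_measure P' by fact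
    have "measure P A = measure P (A \<inter> S) + measure P (A \<inter> - S)"
      using A S s by (subst P.finite_measure_Union[symmetric]) (auto intro!: arg_cong[where f="measure P"])
    moreover have "measure P (A \<inter> - S) \<le> measure P (- S)"
      using A S s by (intro P.finite_measure_mono) auto
    moreover have "measure N (A \<inter> S) \<le> measure N S"
      using A S s by (intro N.finite_measure_mono) auto
    ultimately have "measure P A \<le> \<mu> (A \<inter> S)"
      using S by (simp add: m(1) measure_le_0_iff)
    also have "\<dots> \<le> measure P' (A \<inter> S)" by (simp add: m(2))
    also have "\<dots> \<le> measure P' A"
      using A S s by (intro P'.finite_measure_mono) auto
    finally show ?thesis .
  qed
  have s: "sets P = sets borel" "sets N = sets borel" "sets P' = sets borel" "sets N' = sets borel"
    and f: "finite_measure P" "finite_measure N" "finite_measure P'" "finite_measure N'"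
    and m: "\<mu> = measure P - measure N" "\<mu> = measure P' - measure N'"
    using assms by (auto simp: jordan_decomposition_def decomposition_def pos_measures_def)
  have p: "measure P A = measure P' A" if "A \<in> sets borel" for A
    using le[OF assms that] le[OF assms(2,1) that] by simp
  have "P = P'"
    using s f p by (intro measure_eqI) (auto simp: finite_measure.emeasure_eq_measure)
  moreover have "measure N A = measure N' A" if "A \<in> sets borel" for A
    using fun_cong[OF trans[OF m(1)[symmetric] m(2)], of A] p[OF that] by simp
  then have "N = N'"
    using s f by (intro measure_eqI) (auto simp: finite_measure.emeasure_eq_measure)
  ultimately show ?thesis ..
qed

lemma jordan_decomposition_parts:
  assumes "\<mu> \<in> signed_measures"
  shows "jordan_decomposition \<mu> (pos_part \<mu>) (neg_part \<mu>)"
proof -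
  obtain P N where j: "jordan_decomposition \<mu> P N"
    using jordan_decomposition_exists[OF assms] by blast
  have "pos_part \<mu> = P" "neg_part \<mu> = N"
    unfolding pos_part_def neg_part_def using j jordan_decomposition_unique by blast+
  then show ?thesis using j by simp
qed

end

theory Submission
  imports Defs "HOL-Probability.Helly_Selection"
begin

text \<open>
  Integration of a bounded Lipschitz function is continuous for the norm, so along the sequence such
  integrals converge. By tightness, subsequences of the positive and negative parts converge
  weakly, which identifies a limit \<open>\<nu>\<close>. The compactness is transported from the real line (Helly) to
  Euclidean space by a Borel coding into the reals with a continuous left inverse.

  To see that the norm of \<open>\<sigma> = \<mu> n - \<nu>\<close> tends to 0, no duality is needed. Every decomposition of
  \<open>\<sigma>\<close> arises from the Jordan decomposition \<open>(J, J')\<close> by adding a common measure, which does not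
  increase \<open>W1ab\<close>. On a compact set carrying most of the mass take a fixed finite Lipschitz partition
  of unity \<open>\<phi> i\<close> with small supports: the masses that \<open>J\<close> and \<open>J'\<close> give to \<open>\<phi> i\<close> differ by
  \<open>\<integral> \<phi> i d\<sigma>\<close>, which tends to 0, and the common mass is transported within the support of \<open>\<phi> i\<close>.
\<close>

subsection \<open>Sums of measures\<close>

text \<open>The norm is evaluated at a decomposition about which nothing else is known, so each
  estimate is one-sided: the bound of \<open>signed_integral\<close> by \<open>norm_ab\<close> is
  proved for all decompositions, while the upper bound of \<open>norm_ab\<close> is reduced to the
  Jordan one. Weak limits of \<open>pos_part (\<mu> n)\<close> and \<open>neg_part (\<mu> n)\<close>
  exist only along a subsequence and need not be the Jordan parts of \<open>\<nu>\<close>. The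
  Cauchy property carries the integral of each fixed Lipschitz function to its limit along the whole
  sequence. The Jordan parts of \<open>\<mu> n - \<nu>\<close> need not converge at all. Only
  finitely many test integrals can be made small at once, so the partition has to be chosen before
  \<open>n\<close>: tightness lets one finite partition serve all \<open>n\<close>, and the mass
  bound keeps the cost of moving mass by at most \<open>\<delta>\<close> small.\<close>

definition add_measure :: "'a measure \<Rightarrow> 'a measure \<Rightarrow> 'a measure" where
  "add_measure M N = measure_of (space M) (sets M) (\<lambda>A. emeasure M A + emeasure N A)"

lemma space_add_measure [simp]: "space (add_measure M N) = space M"
  and sets_add_measure [simp, measurable_cong]: "sets (add_measure M N) = sets M"
  by (auto simp: add_measure_def)

lemma emeasure_add_measure:
  assumes "sets N = sets M" "A \<in> sets M"
  shows "emeasure (add_measure M N) A = emeasure M A + emeasure N A"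
  unfolding add_measure_def
proof (rule emeasure_measure_of_sigma)
  show "countably_additive (sets M) (\<lambda>A. emeasure M A + emeasure N A)"
  proof (rule countably_additiveI)
    fix A :: "nat \<Rightarrow> _" assume A: "range A \<subseteq> sets M" "disjoint_family A"
    with assms(1) show "(\<Sum>i. emeasure M (A i) + emeasure N (A i)) =
        emeasure M (\<Union>i. A i) + emeasure N (\<Union>i. A i)"
      by (simp add: suminf_add[symmetric] suminf_emeasure)
  qed
qed (use assms in \<open>auto simp: sets.sigma_algebra_axioms positive_def\<close>)

lemma nn_integral_add_measure:
  assumes s: "sets N = sets M" and f: "f \<in> borel_measurable M"
  shows "integral\<^sup>N (add_measure M N) f = integral\<^sup>N M f + integral\<^sup>N N f"
proof -
  have [measurable_cong]: "sets N = sets M" by fact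
  have sp: "space N = space M" using s by (rule sets_eq_imp_space_eq)
  from f show ?thesis
  proof induct
    case (cong f g)
    \<comment> \<open>Stated for every \<open>L\<close> on this space because the goal involves
      three different measures.\<close>
    have "integral\<^sup>N L f = integral\<^sup>N L g" if "space L = space M" for L
      using cong(3) that by (auto intro!: nn_integral_cong)
    with cong(4) sp show ?case by simp
  next
    case (set A)
    then show ?case using s by (simp add: emeasure_add_measure)
  next
    case (mult u c)
    then show ?case by (simp add: nn_integral_cmult distrib_left)
  next
    case (add u v)
    then show ?case by (simp add: nn_integral_add ac_simps)
  next
    case (seq U)
    \<comment> \<open>Both sequences increase, so the supremum of the sums is the sum of the
      suprema.\<close>
    have "incseq (\<lambda>i. integral\<^sup>N M (U i))" "incseq (\<lambda>i. integral\<^sup>N N (U i))"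
      using seq(4) by (auto simp: incseq_def le_fun_def intro!: nn_integral_mono)
    with seq show ?case
      by (simp add: image_comp nn_integral_monotone_convergence_SUP SUP_apply ennreal_SUP_add)
  qed
qed

lemma pos_measuresD:
  assumes "M \<in> pos_measures"
  shows "sets M = sets borel" "space M = UNIV" "finite_measure M"
  using assms sets_eq_imp_space_eq[of M borel] by (auto simp: pos_measures_def)

lemma add_measure_pos_measures:
  assumes "M \<in> pos_measures" "N \<in> pos_measures"
  shows "add_measure M N \<in> pos_measures"
proof -
  note M = pos_measuresD[OF assms(1)] and N = pos_measuresD[OF assms(2)]
  interpret M: finite_measure M by (rule M)
  interpret N: finite_measure N by (rule N)
  have "finite_measure (add_measure M N)"
    by (rule finite_measureI) (use M N in \<open>auto simp: emeasure_add_measure\<close>)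
  then show ?thesis using M by (simp add: pos_measures_def)
qed

lemma null_measure_pos_measures: "null_measure borel \<in> pos_measures"
  by (auto simp: pos_measures_def intro!: finite_measureI)

lemma measure_add_measure:
  assumes "M \<in> pos_measures" "N \<in> pos_measures"
  shows "measure (add_measure M N) A = measure M A + measure N A"
proof (cases "A \<in> sets borel")
  case True
  note M = pos_measuresD[OF assms(1)] and N = pos_measuresD[OF assms(2)]
  interpret M: finite_measure M by (rule M)
  interpret N: finite_measure N by (rule N)
  show ?thesis
    unfolding measure_def using True M N
    by (simp add: emeasure_add_measure enn2real_plus flip: less_top)
next
  case False
  then show ?thesis
    using pos_measuresD[OF assms(1)] pos_measuresD[OF assms(2)] by (simp add: measure_notin_sets)
qed

lemma pos_measures_eqI:
  assumes "M \<in> pos_measures" "N \<in> pos_measures" "\<And>A. A \<in> sets borel \<Longrightarrow> measure M A = measure N A"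
  shows "M = N"
  using assms
  by (intro measure_eqI) (auto simp: pos_measures_def finite_measure.emeasure_eq_measure)

lemma integrable_bounded_pos_measures:
  fixes \<phi> :: "'a::euclidean_space \<Rightarrow> real"
  assumes "M \<in> pos_measures" "\<phi> \<in> borel_measurable borel" "\<And>x. \<bar>\<phi> x\<bar> \<le> B"
  shows "integrable M \<phi>"
proof -
  note M = pos_measuresD[OF assms(1)]
  interpret M: finite_measure M by (rule M)
  show ?thesis
    by (rule M.integrable_const_bound[of _ B]) (use assms M in \<open>auto simp: measurable_def\<close>)
qed

lemma abs_integral_le_pos_measures:
  fixes \<phi> :: "'a::euclidean_space \<Rightarrow> real"
  assumes "M \<in> pos_measures" "\<phi> \<in> borel_measurable borel" "\<And>x. \<bar>\<phi> x\<bar> \<le> B"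
  shows "\<bar>integral\<^sup>L M \<phi>\<bar> \<le> B * measure M UNIV"
proof -
  note M = pos_measuresD[OF assms(1)]
  interpret M: finite_measure M by (rule M)
  have "\<bar>integral\<^sup>L M \<phi>\<bar> \<le> (\<integral>x. \<bar>\<phi> x\<bar> \<partial>M)"
    by (rule integral_abs_bound)
  also have "\<dots> \<le> (\<integral>x. B \<partial>M)"
    using integrable_bounded_pos_measures[OF assms] assms(3) by (intro integral_mono) auto
  finally show ?thesis using M by (simp add: mult.commute)
qed

lemma integral_add_measure:
  fixes \<phi> :: "'a::euclidean_space \<Rightarrow> real"
  assumes "M \<in> pos_measures" "N \<in> pos_measures" "\<phi> \<in> borel_measurable borel" "\<And>x. \<bar>\<phi> x\<bar> \<le> B"
  shows "integral\<^sup>L (add_measure M N) \<phi> = integral\<^sup>L M \<phi> + integral\<^sup>L N \<phi>"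
proof -
  note M = pos_measuresD[OF assms(1)] and N = pos_measuresD[OF assms(2)]
  have [measurable_cong]: "sets M = sets borel" by (rule M)
  have i: "integrable M \<phi>" "integrable N \<phi>" "integrable (add_measure M N) \<phi>"
    using assms by (auto intro!: integrable_bounded_pos_measures add_measure_pos_measures)
  \<comment> \<open>Finiteness makes \<open>enn2real\<close> additive on the integrals of the
    positive and the negative part.\<close>
  have "(\<integral>\<^sup>+x. ennreal (\<phi> x) \<partial>L) < top" "(\<integral>\<^sup>+x. ennreal (- \<phi> x) \<partial>L) < top" if "integrable L \<phi>" for L
    using that by (auto simp: real_integrable_def less_top)
  then show ?thesis
    using i assms(3) M N
    by (simp add: real_lebesgue_integral_def nn_integral_add_measure enn2real_plus)
qed

subsection \<open>Integration against signed measures\<close>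

text \<open>The Jordan parts serve as canonical representatives; for bounded Borel functions
  \<open>signed_integral_decomposition\<close> allows any other decomposition.\<close>

definition signed_integral :: "('a::euclidean_space set \<Rightarrow> real) \<Rightarrow> ('a \<Rightarrow> real) \<Rightarrow> real" where
  "signed_integral \<mu> \<phi> = integral\<^sup>L (pos_part \<mu>) \<phi> - integral\<^sup>L (neg_part \<mu>) \<phi>"

lemma decomposition_imp_signed:
  "decomposition \<mu> P N \<Longrightarrow> \<mu> \<in> signed_measures"
  by (auto simp: signed_measures_def)

lemma decompositionD:
  assumes "decomposition \<mu> P N"
  shows "P \<in> pos_measures" "N \<in> pos_measures" "\<mu> = measure P - measure N"
  using assms by (auto simp: decomposition_def)

lemma decomposition_pos_neg_part:
  "\<mu> \<in> signed_measures \<Longrightarrow> decomposition \<mu> (pos_part \<mu>) (neg_part \<mu>)"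
  using jordan_decomposition_parts jordan_decomposition_def by blast

text \<open>From \<open>P - N = P' - N'\<close> follows \<open>P + N' = P' + N\<close>, an identity
  of positive measures whose two sides can be integrated.\<close>

lemma signed_integral_decomposition:
  fixes \<phi> :: "'a::euclidean_space \<Rightarrow> real"
  assumes d: "decomposition \<mu> P N" and \<phi>: "\<phi> \<in> borel_measurable borel" "\<And>x. \<bar>\<phi> x\<bar> \<le> B"
  shows "signed_integral \<mu> \<phi> = integral\<^sup>L P \<phi> - integral\<^sup>L N \<phi>"
proof -
  define P' N' where "P' = pos_part \<mu>" and "N' = neg_part \<mu>"
  note D = decompositionD[OF d]
    decompositionD[OF decomposition_pos_neg_part[OF decomposition_imp_signed[OF d]], folded P'_def N'_def]
  have "measure P A - measure N A = measure P' A - measure N' A" for A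
    using D(3,6) by (metis minus_apply)
  then have "add_measure P N' = add_measure P' N"
    using D by (intro pos_measures_eqI add_measure_pos_measures) (auto simp: measure_add_measure algebra_simps)
  then have "integral\<^sup>L (add_measure P N') \<phi> = integral\<^sup>L (add_measure P' N) \<phi>" by simp
  then show ?thesis
    using D(1,2,4,5) by (simp add: integral_add_measure[OF _ _ \<phi>] signed_integral_def P'_def N'_def)
qed

lemma decomposition_diff:
  assumes "decomposition \<mu> P N" "decomposition \<nu> P' N'"
  shows "decomposition (\<mu> - \<nu>) (add_measure P N') (add_measure N P')"
  using assms
  by (auto simp: decomposition_def add_measure_pos_measures measure_add_measure fun_eq_iff)

lemma signed_integral_diff:
  fixes \<phi> :: "'a::euclidean_space \<Rightarrow> real"
  assumes "\<mu> \<in> signed_measures" "\<nu> \<in> signed_measures"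
    and \<phi>: "\<phi> \<in> borel_measurable borel" "\<And>x. \<bar>\<phi> x\<bar> \<le> B"
  shows "signed_integral (\<mu> - \<nu>) \<phi> = signed_integral \<mu> \<phi> - signed_integral \<nu> \<phi>"
proof -
  note d = decomposition_pos_neg_part[OF assms(1)] decomposition_pos_neg_part[OF assms(2)]
  show ?thesis
    using decompositionD(1,2)[OF d(1)] decompositionD(1,2)[OF d(2)]
    by (subst signed_integral_decomposition[OF decomposition_diff[OF d] \<phi>])
      (simp_all add: integral_add_measure[OF _ _ \<phi>] signed_integral_def)
qed

lemma signed_measures_diff:
  "\<mu> \<in> signed_measures \<Longrightarrow> \<nu> \<in> signed_measures \<Longrightarrow> \<mu> - \<nu> \<in> signed_measures"
  using decomposition_diff decomposition_imp_signed decomposition_pos_neg_part by blast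

text \<open>Minimality of the Jordan decomposition: the positive part lives on a set
  \<open>S\<close> that is null for the negative part, so its value on \<open>A\<close> is
  \<open>\<mu> (A \<inter> S)\<close>, which is at most \<open>measure P (A \<inter> S)\<close>. The
  negative part follows because both pairs have the same difference.\<close>

lemma pos_neg_part_le:
  assumes d: "decomposition \<mu> P N" and A: "A \<in> sets borel"
  shows "measure (pos_part \<mu>) A \<le> measure P A" "measure (neg_part \<mu>) A \<le> measure N A"
proof -
  define P' N' where "P' = pos_part \<mu>" and "N' = neg_part \<mu>"
  have j: "jordan_decomposition \<mu> P' N'"
    using jordan_decomposition_parts[OF decomposition_imp_signed[OF d]] by (simp add: P'_def N'_def)
  then obtain S where S: "S \<in> sets borel" "measure P' (- S) = 0" "measure N' S = 0"
    by (auto simp: jordan_decomposition_def)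
  have D: "P' \<in> pos_measures" "N' \<in> pos_measures" "\<mu> = measure P' - measure N'"
    using j by (auto simp: jordan_decomposition_def decomposition_def)
  note D' = decompositionD[OF d]
  interpret P: finite_measure P using D' by (auto dest: pos_measuresD)
  interpret P': finite_measure P' using D by (auto dest: pos_measuresD)
  interpret N': finite_measure N' using D by (auto dest: pos_measuresD)
  note s = pos_measuresD(1)[OF D(1)] pos_measuresD(1)[OF D(2)] pos_measuresD(1)[OF D'(1)]
  have eq: "measure P A - measure N A = measure P' A - measure N' A" for A
    using D(3) D'(3) by (metis minus_apply)
  have "measure P' A = measure P' (A \<inter> S) + measure P' (A \<inter> - S)"
    using A S s by (subst P'.finite_measure_Union[symmetric]) (auto intro!: arg_cong[where f="measure P'"])
  moreover have "measure P' (A \<inter> - S) \<le> measure P' (- S)"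
    using A S s by (intro P'.finite_measure_mono) auto
  moreover have "measure N' (A \<inter> S) \<le> measure N' S"
    using A S s by (intro N'.finite_measure_mono) auto
  moreover have "measure P (A \<inter> S) \<le> measure P A"
    using A S s by (intro P.finite_measure_mono) auto
  ultimately have "measure P' A \<le> measure P A"
    using S eq[of "A \<inter> S"] measure_nonneg[of N "A \<inter> S"] measure_nonneg[of N' "A \<inter> S"] by linarith
  then show "measure (pos_part \<mu>) A \<le> measure P A" "measure (neg_part \<mu>) A \<le> measure N A"
    using eq[of A] by (simp_all add: P'_def N'_def)
qed

lemma total_mass_le:
  "decomposition \<mu> P N \<Longrightarrow> total_mass \<mu> \<le> measure P UNIV + measure N UNIV"
  using pos_neg_part_le[of \<mu> P N UNIV] by (simp add: total_mass_def)

subsection \<open>Bounded Lipschitz test functions\<close>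

lemma lipschitz_on_borel_measurable:
  "L-lipschitz_on UNIV \<phi> \<Longrightarrow> \<phi> \<in> borel_measurable borel"
  for \<phi> :: "'a::euclidean_space \<Rightarrow> real"
  by (intro borel_measurable_continuous_onI lipschitz_on_continuous_on)

lemma couplingsD:
  fixes M N :: "'a::euclidean_space measure"
  assumes "\<pi> \<in> couplings M N"
  shows "sets \<pi> = sets borel" "space \<pi> = UNIV" "distr \<pi> borel fst = M" "distr \<pi> borel snd = N"
    "fst \<in> \<pi> \<rightarrow>\<^sub>M borel" "snd \<in> \<pi> \<rightarrow>\<^sub>M borel"
proof -
  show s: "sets \<pi> = sets borel" and "distr \<pi> borel fst = M" "distr \<pi> borel snd = N"
    using assms by (auto simp: couplings_def)
  show "space \<pi> = UNIV" using sets_eq_imp_space_eq[OF s] by simp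
  have "fst \<in> borel \<rightarrow>\<^sub>M (borel :: 'a measure)" "snd \<in> borel \<rightarrow>\<^sub>M (borel :: 'a measure)"
    by (auto intro!: borel_measurable_continuous_onI continuous_intros)
  then show "fst \<in> \<pi> \<rightarrow>\<^sub>M borel" "snd \<in> \<pi> \<rightarrow>\<^sub>M borel"
    by (simp_all add: measurable_cong_sets[OF s refl])
qed

text \<open>The easy half of Kantorovich-Rubinstein duality: integrate
  \<open>\<bar>\<phi> x - \<phi> y\<bar> \<le> L * norm (x - y)\<close> against an arbitrary
  coupling.\<close>

lemma lipschitz_integral_le_W1:
  fixes \<phi> :: "'a::euclidean_space \<Rightarrow> real"
  assumes M: "M \<in> pos_measures" and N: "N \<in> pos_measures"
    and L: "L-lipschitz_on UNIV \<phi>" "L > 0" and B: "\<And>x. \<bar>\<phi> x\<bar> \<le> B"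
  shows "ennreal (\<bar>integral\<^sup>L M \<phi> - integral\<^sup>L N \<phi>\<bar> / L) \<le> W1 M N"
  unfolding W1_def
proof (rule INF_greatest)
  fix \<pi> assume "\<pi> \<in> couplings M N"
  note \<pi> = couplingsD[OF this]
  note [measurable] = \<pi>(5,6)
  have [measurable]: "\<phi> \<in> borel_measurable borel"
    using L by (intro lipschitz_on_borel_measurable)
  have i: "integrable (distr \<pi> borel fst) \<phi>" "integrable (distr \<pi> borel snd) \<phi>"
    using \<pi>(3,4) M N B by (auto intro!: integrable_bounded_pos_measures)
  then have i': "integrable \<pi> (\<lambda>z. \<phi> (fst z))" "integrable \<pi> (\<lambda>z. \<phi> (snd z))"
    by (simp_all add: integrable_distr_eq)
  have e: "integral\<^sup>L M \<phi> - integral\<^sup>L N \<phi> = (\<integral>z. \<phi> (fst z) - \<phi> (snd z) \<partial>\<pi>)"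
    using i' by (simp add: integral_distr flip: \<pi>(3,4))
  have "ennreal \<bar>integral\<^sup>L M \<phi> - integral\<^sup>L N \<phi>\<bar> \<le> (\<integral>\<^sup>+z. ennreal \<bar>\<phi> (fst z) - \<phi> (snd z)\<bar> \<partial>\<pi>)"
    unfolding e using i' integral_norm_bound_ennreal[of \<pi> "\<lambda>z. \<phi> (fst z) - \<phi> (snd z)"] by simp
  also have "\<dots> \<le> (\<integral>\<^sup>+z. ennreal L * ennreal (norm (fst z - snd z)) \<partial>\<pi>)"
    using lipschitz_onD[OF L(1)] L(2)
    by (intro nn_integral_mono) (auto simp: dist_norm simp flip: ennreal_mult)
  also have "\<dots> = ennreal L * (\<integral>\<^sup>+z. ennreal (norm (fst z - snd z)) \<partial>\<pi>)"
    by (intro nn_integral_cmult) measurable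
  finally have "ennreal (1 / L) * ennreal \<bar>integral\<^sup>L M \<phi> - integral\<^sup>L N \<phi>\<bar>
      \<le> ennreal (1 / L) * (ennreal L * (\<integral>\<^sup>+z. ennreal (norm (fst z - snd z)) \<partial>\<pi>))"
    by (rule mult_left_mono) simp
  then show "ennreal (\<bar>integral\<^sup>L M \<phi> - integral\<^sup>L N \<phi>\<bar> / L) \<le> (\<integral>\<^sup>+z. ennreal (norm (fst z - snd z)) \<partial>\<pi>)"
    using L(2) by (simp add: mult.assoc[symmetric] flip: ennreal_mult)
qed

lemma abs_signed_integral_le_total_mass:
  fixes \<phi> :: "'a::euclidean_space \<Rightarrow> real"
  assumes "\<mu> \<in> signed_measures" "\<phi> \<in> borel_measurable borel" "\<And>x. \<bar>\<phi> x\<bar> \<le> B"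
  shows "\<bar>signed_integral \<mu> \<phi>\<bar> \<le> B * total_mass \<mu>"
proof -
  note d = decompositionD[OF decomposition_pos_neg_part[OF assms(1)]]
  show ?thesis
    using abs_integral_le_pos_measures[OF d(1) assms(2,3)] abs_integral_le_pos_measures[OF d(2) assms(2,3)]
    unfolding signed_integral_def total_mass_def by (simp add: distrib_left)
qed

lemma measure_diff_decomposition:
  "P \<in> pos_measures \<Longrightarrow> N \<in> pos_measures \<Longrightarrow> decomposition (measure P - measure N) P N"
  by (simp add: decomposition_def)

lemma total_mass_nonneg: "0 \<le> total_mass \<mu>"
  by (simp add: total_mass_def)

text \<open>Changing a unit of mass costs \<open>a\<close> and alters the integral by at most
  \<open>B\<close>; moving a unit of mass by a unit of length costs \<open>b\<close> and alters it
  by at most \<open>L\<close>. The constant \<open>B / a + L / b\<close> dominates both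
  ratios.\<close>

lemma abs_signed_integral_le_W1ab:
  fixes \<phi> :: "'a::euclidean_space \<Rightarrow> real"
  assumes a: "a > 0" "b > 0" and d: "decomposition \<mu> P N"
    and L: "L-lipschitz_on UNIV \<phi>" "L > 0" and B: "\<And>x. \<bar>\<phi> x\<bar> \<le> B"
  shows "ennreal \<bar>signed_integral \<mu> \<phi>\<bar> \<le> ennreal (B / a + L / b) * W1ab a b P N"
proof -
  define K where "K = B / a + L / b"
  have m: "\<phi> \<in> borel_measurable borel"
    using L by (intro lipschitz_on_borel_measurable)
  have B0: "0 \<le> B" using B[of 0] by linarith
  then have K: "K > 0" "B \<le> K * a" "L \<le> K * b"
    using a L(2) by (auto simp: K_def field_simps add_nonneg_pos)
  note D = decompositionD[OF d]
  have "ennreal (\<bar>signed_integral \<mu> \<phi>\<bar> / K) \<le> W1ab a b P N"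
    unfolding W1ab_def
  proof (safe intro!: INF_greatest)
    fix M' N' :: "'a measure"
    assume M': "M' \<in> pos_measures" and N': "N' \<in> pos_measures"
    define p q where "p = signed_integral (measure P - measure M') \<phi>"
      and "q = signed_integral (measure N - measure N') \<phi>"
    define w where "w = integral\<^sup>L M' \<phi> - integral\<^sup>L N' \<phi>"
    define s where "s = total_mass (measure P - measure M')"
    define t where "t = total_mass (measure N - measure N')"
    have p: "p = integral\<^sup>L P \<phi> - integral\<^sup>L M' \<phi>" and q: "q = integral\<^sup>L N \<phi> - integral\<^sup>L N' \<phi>"
      unfolding p_def q_def
      using signed_integral_decomposition[OF measure_diff_decomposition m B] M' N' D by auto
    have pq: "\<bar>p\<bar> \<le> B * s" "\<bar>q\<bar> \<le> B * t"
      unfolding p_def q_def s_def t_def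
      using abs_signed_integral_le_total_mass[OF decomposition_imp_signed[OF measure_diff_decomposition] m B] M' N' D
      by auto
    have st: "0 \<le> s" "0 \<le> t" by (auto simp: s_def t_def total_mass_nonneg)
    \<comment> \<open>Telescoping along the path from \<open>P\<close> to \<open>M'\<close>, then to
      \<open>N'\<close>, then to \<open>N\<close>.\<close>
    have e: "signed_integral \<mu> \<phi> = p - q + w"
      using signed_integral_decomposition[OF d m B] by (simp add: p q w_def)
    have "\<bar>signed_integral \<mu> \<phi>\<bar> \<le> B * (s + t) + \<bar>w\<bar>"
      using pq e by (simp add: distrib_left)
    also have "\<dots> \<le> (K * a) * (s + t) + (K * b / L) * \<bar>w\<bar>"
      using K L(2) st mult_right_mono[of 1 "K * b / L" "\<bar>w\<bar>"]
      by (intro add_mono mult_right_mono) auto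
    also have "\<dots> = K * (a * (s + t) + b * (\<bar>w\<bar> / L))"
      by (simp add: field_simps)
    finally have "\<bar>signed_integral \<mu> \<phi>\<bar> / K \<le> a * (s + t) + b * (\<bar>w\<bar> / L)"
      using K(1) by (simp add: pos_divide_le_eq mult.commute)
    then have "ennreal (\<bar>signed_integral \<mu> \<phi>\<bar> / K) \<le> ennreal (a * (s + t) + b * (\<bar>w\<bar> / L))"
      by (rule ennreal_leI)
    also have "\<dots> = ennreal (a * (s + t)) + ennreal b * ennreal (\<bar>w\<bar> / L)"
      using a st L(2) by (simp flip: ennreal_mult)
    also have "\<dots> \<le> ennreal (a * (s + t)) + ennreal b * W1 M' N'"
      unfolding w_def using lipschitz_integral_le_W1[OF M' N' L B] by (intro add_left_mono mult_left_mono) auto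
    finally show "ennreal (\<bar>signed_integral \<mu> \<phi>\<bar> / K)
      \<le> ennreal (a * (total_mass (measure P - measure M') + total_mass (measure N - measure N')))
        + ennreal b * W1 M' N'"
      by (simp add: s_def t_def)
  qed
  then have "ennreal K * ennreal (\<bar>signed_integral \<mu> \<phi>\<bar> / K) \<le> ennreal K * W1ab a b P N"
    by (rule mult_left_mono) simp
  then show ?thesis
    using K by (simp add: K_def[symmetric] flip: ennreal_mult)
qed

text \<open>Opens the choice operator: of the chosen pair only the fact that it is a decomposition
  is retained.\<close>

lemma norm_ab_decomposition:
  assumes "\<mu> \<in> signed_measures"
  obtains P N where "decomposition \<mu> P N" "norm_ab a b \<mu> = enn2real (W1ab a b P N)"
proof -
  have ex: "\<exists>z. case z of (P, N) \<Rightarrow> decomposition \<mu> P N"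
    using assms by (auto simp: signed_measures_def)
  define z where "z = (SOME (P, N). decomposition \<mu> P N)"
  have "case z of (P, N) \<Rightarrow> decomposition \<mu> P N"
    unfolding z_def by (rule someI_ex[OF ex])
  moreover have "norm_ab a b \<mu> = (case z of (P, N) \<Rightarrow> enn2real (W1ab a b P N))"
    unfolding norm_ab_def z_def Let_def ..
  ultimately show ?thesis
    by (cases z) (auto intro: that)
qed

lemma abs_signed_integral_le_norm_ab:
  fixes \<phi> :: "'a::euclidean_space \<Rightarrow> real"
  assumes a: "a > 0" "b > 0" and \<mu>: "\<mu> \<in> signed_measures"
    and L: "L-lipschitz_on UNIV \<phi>" "L > 0" and B: "\<And>x. \<bar>\<phi> x\<bar> \<le> B"
  shows "\<bar>signed_integral \<mu> \<phi>\<bar> \<le> (B / a + L / b) * norm_ab a b \<mu>"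
proof -
  obtain P N where PN: "decomposition \<mu> P N" "norm_ab a b \<mu> = enn2real (W1ab a b P N)"
    using norm_ab_decomposition[OF \<mu>] .
  have "0 \<le> B" using B[of 0] by linarith
  then have K: "0 \<le> B / a + L / b" using a L by simp
  have "W1ab a b P N = ennreal (norm_ab a b \<mu>)"
    using W1ab_finite[of a b P N] PN by simp
  then have "ennreal \<bar>signed_integral \<mu> \<phi>\<bar> \<le> ennreal ((B / a + L / b) * norm_ab a b \<mu>)"
    using abs_signed_integral_le_W1ab[OF a PN(1) L B] K by (simp add: ennreal_mult' )
  then show ?thesis
    using K PN(2) by (subst (asm) ennreal_le_iff) auto
qed

subsection \<open>Comparison with the Jordan decomposition\<close>

lemma distr_add_measure:
  assumes "sets N = sets M" "f \<in> M \<rightarrow>\<^sub>M L"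
  shows "distr (add_measure M N) L f = add_measure (distr M L f) (distr N L f)"
proof (rule measure_eqI)
  fix A assume A: "A \<in> sets (distr (add_measure M N) L f)"
  have "f \<in> N \<rightarrow>\<^sub>M L" "f \<in> add_measure M N \<rightarrow>\<^sub>M L"
    using assms(2) by (simp_all cong: measurable_cong_sets add: measurable_cong_sets[OF assms(1) refl])
  moreover have "space N = space M" by (rule sets_eq_imp_space_eq) fact
  ultimately show "emeasure (distr (add_measure M N) L f) A = emeasure (add_measure (distr M L f) (distr N L f)) A"
    using A assms by (simp add: emeasure_distr emeasure_add_measure measurable_sets)
qed simp

text \<open>The common part \<open>R\<close> stays where it is: its image on the diagonal is added
  to the plan, at no cost.\<close>

lemma W1_add_same_le:
  fixes M N R :: "'a::euclidean_space measure"
  assumes R: "R \<in> pos_measures"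
  shows "W1 (add_measure M R) (add_measure N R) \<le> W1 M N"
proof (subst (2) W1_def, rule INF_greatest)
  fix \<pi> assume "\<pi> \<in> couplings M N"
  note \<pi> = couplingsD[OF this]
  note R = pos_measuresD[OF R]
  have cost: "(\<lambda>z. ennreal (norm (fst z - snd z))) \<in> borel_measurable \<pi>"
    using \<pi>(5,6) by measurable
  note [measurable_cong] = R(1)
  have [measurable]: "(\<lambda>x. (x, x)) \<in> borel \<rightarrow>\<^sub>M (borel :: ('a \<times> 'a) measure)"
    by (auto intro!: borel_measurable_continuous_onI continuous_intros)
  have [measurable]: "fst \<in> borel \<rightarrow>\<^sub>M (borel :: 'a measure)" "snd \<in> borel \<rightarrow>\<^sub>M (borel :: 'a measure)"
    by (auto intro!: borel_measurable_continuous_onI continuous_intros)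
  define D where "D = distr R borel (\<lambda>x. (x, x))"
  have sD: "sets D = sets \<pi>" by (simp add: D_def \<pi>)
  have "distr D borel fst = R" "distr D borel snd = R"
    unfolding D_def using R(1) by (simp_all add: distr_distr comp_def distr_id2)
  then have "add_measure \<pi> D \<in> couplings (add_measure M R) (add_measure N R)"
    using \<pi> sD by (simp add: couplings_def distr_add_measure)
  then have "W1 (add_measure M R) (add_measure N R) \<le>
      (\<integral>\<^sup>+ z. ennreal (norm (fst z - snd z)) \<partial>add_measure \<pi> D)"
    unfolding W1_def by (rule INF_lower)
  also have "\<dots> = (\<integral>\<^sup>+ z. ennreal (norm (fst z - snd z)) \<partial>\<pi>) + (\<integral>\<^sup>+ z. ennreal (norm (fst z - snd z)) \<partial>D)"
    using sD cost by (intro nn_integral_add_measure)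
  also have "(\<integral>\<^sup>+ z. ennreal (norm (fst z - snd z)) \<partial>D) = 0"
    by (simp add: D_def nn_integral_distr)
  finally show "W1 (add_measure M R) (add_measure N R) \<le> (\<integral>\<^sup>+ z. ennreal (norm (fst z - snd z)) \<partial>\<pi>)"
    by simp
qed

text \<open>Adding \<open>R\<close> to both members of a competitor leaves the changed masses
  \<open>M - M'\<close> and \<open>N - N'\<close> as they are and does not raise the transport
  cost.\<close>

lemma W1ab_add_same_le:
  fixes M N R :: "'a::euclidean_space measure"
  assumes R: "R \<in> pos_measures" and M: "M \<in> pos_measures" and N: "N \<in> pos_measures"
  shows "W1ab a b (add_measure M R) (add_measure N R) \<le> W1ab a b M N"
proof (subst (2) W1ab_def, safe intro!: INF_greatest)
  fix M' N' :: "'a measure"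
  assume M': "M' \<in> pos_measures" and N': "N' \<in> pos_measures" and eq: "measure M' UNIV = measure N' UNIV"
  let ?M = "add_measure M' R" and ?N = "add_measure N' R"
  have d: "measure (add_measure M R) - measure ?M = measure M - measure M'"
    "measure (add_measure N R) - measure ?N = measure N - measure N'"
    using assms M' N' by (auto simp: fun_eq_iff measure_add_measure)
  have "W1ab a b (add_measure M R) (add_measure N R) \<le>
      ennreal (a * (total_mass (measure (add_measure M R) - measure ?M)
        + total_mass (measure (add_measure N R) - measure ?N)))
      + ennreal b * W1 ?M ?N"
    unfolding W1ab_def using assms M' N' eq
    by (intro INF_lower2[of "(?M, ?N)"]) (auto simp: add_measure_pos_measures measure_add_measure)
  also have "\<dots> \<le> ennreal (a * (total_mass (measure M - measure M') + total_mass (measure N - measure N')))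
      + ennreal b * W1 M' N'"
    unfolding d by (intro add_left_mono mult_left_mono W1_add_same_le R) simp
  finally show "W1ab a b (add_measure M R) (add_measure N R) \<le>
      ennreal (a * (total_mass (measure M - measure M') + total_mass (measure N - measure N')))
      + ennreal b * W1 M' N'" .
qed

text \<open>Take \<open>R\<close> as \<open>P\<close> minus the positive part, which is a measure by
  minimality. The same \<open>R\<close> serves for \<open>N\<close> since the two pairs have equal
  differences.\<close>

lemma decomposition_eq_jordan_add:
  assumes d: "decomposition \<mu> P N"
  obtains R where "R \<in> pos_measures" "P = add_measure (pos_part \<mu>) R" "N = add_measure (neg_part \<mu>) R"
proof -
  define P' N' where "P' = pos_part \<mu>" and "N' = neg_part \<mu>"
  note D = decompositionD[OF d]
    decompositionD[OF decomposition_pos_neg_part[OF decomposition_imp_signed[OF d]], folded P'_def N'_def]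
  note le = pos_neg_part_le(1)[OF d, folded P'_def]
  note sP = pos_measuresD[OF D(1)] and sP' = pos_measuresD[OF D(4)]
  interpret P: finite_measure P by (rule sP)
  interpret P': finite_measure P' by (rule sP')
  define R where "R = diff_measure P P'"
  have eR: "emeasure R A = ennreal (measure P A - measure P' A)" if "A \<in> sets borel" for A
    unfolding R_def using that sP sP' le
    by (subst emeasure_diff_measure)
      (auto simp: P.emeasure_eq_measure P'.emeasure_eq_measure ennreal_minus)
  have R: "R \<in> pos_measures"
    using eR[of UNIV] sP by (auto simp: pos_measures_def R_def intro!: finite_measureI)
  have mR: "measure R A = measure P A - measure P' A" if "A \<in> sets borel" for A
    using eR[OF that] le[OF that] by (simp add: measure_def)
  have "measure N A = measure N' A + (measure P A - measure P' A)" for A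
  proof -
    have "measure P A - measure N A = measure P' A - measure N' A"
      using D(3,6) by (metis minus_apply)
    then show ?thesis by simp
  qed
  then have "P = add_measure P' R" "N = add_measure N' R"
    using D R by (auto intro!: pos_measures_eqI add_measure_pos_measures simp: measure_add_measure mR)
  with R show ?thesis using that by (simp add: P'_def N'_def)
qed

text \<open>Makes the Jordan parts, whose tails and masses are controlled, available for upper
  bounds on the norm.\<close>

lemma norm_ab_le_jordan:
  assumes "\<mu> \<in> signed_measures"
  shows "norm_ab a b \<mu> \<le> enn2real (W1ab a b (pos_part \<mu>) (neg_part \<mu>))"
proof -
  obtain P N where PN: "decomposition \<mu> P N" "norm_ab a b \<mu> = enn2real (W1ab a b P N)"
    using norm_ab_decomposition[OF assms] .
  obtain R where "R \<in> pos_measures" "P = add_measure (pos_part \<mu>) R" "N = add_measure (neg_part \<mu>) R"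
    using decomposition_eq_jordan_add[OF PN(1)] .
  then have "W1ab a b P N \<le> W1ab a b (pos_part \<mu>) (neg_part \<mu>)"
    using decompositionD[OF decomposition_pos_neg_part[OF assms]] W1ab_add_same_le by blast
  then show ?thesis
    using PN W1ab_finite by (auto intro!: enn2real_mono)
qed

subsection \<open>Transport along a partition of unity\<close>

text \<open>The usual normalization by division is replaced by truncation: hat functions are summed
  one after the other, the partial sums are cut off at 1, and the increments are the
  \<open>\<phi> i\<close>. They telescope to a function that is at most 1 and equals 1 on
  \<open>K\<close>, and minima and differences keep the Lipschitz property.\<close>

lemma lipschitz_partition_of_unity:
  fixes K :: "'a::euclidean_space set"
  assumes K: "compact K" and \<delta>: "\<delta> > 0"
  obtains m :: nat and \<phi> :: "nat \<Rightarrow> 'a \<Rightarrow> real" where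
    "\<forall>i. \<exists>L>0. L-lipschitz_on UNIV (\<phi> i)" "\<forall>i x. 0 \<le> \<phi> i x"
    "\<forall>x. (\<Sum>i<m. \<phi> i x) \<le> 1" "\<forall>x\<in>K. (\<Sum>i<m. \<phi> i x) = 1"
    "\<forall>i x y. \<phi> i x \<noteq> 0 \<longrightarrow> \<phi> i y \<noteq> 0 \<longrightarrow> norm (x - y) \<le> \<delta>"
proof -
  define e where "e = \<delta> / 2"
  have e: "e > 0" using \<delta> by (simp add: e_def)
  obtain C where C: "finite C" "C \<subseteq> K" "K \<subseteq> (\<Union>c\<in>C. ball c (e / 2))"
  proof (rule compactE_image[OF K, of K "\<lambda>c. ball c (e / 2)"])
    show "K \<subseteq> (\<Union>c\<in>K. ball c (e / 2))" using e by auto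
  qed (auto intro: that)
  obtain m and c :: "nat \<Rightarrow> 'a" where c: "C = c ` {i. i < m}"
    using finite_imp_nat_seg_image_inj_on[OF C(1)] by blast
  \<comment> \<open>A hat of radius \<open>e\<close> and slope \<open>2 / e\<close>: at least 1 on
    the ball of radius \<open>e / 2\<close> used in the cover, and zero at distance \<open>e\<close>
    from the centre, so supports have diameter at most \<open>2 * e = \<delta>\<close>.\<close>
  define \<psi> where "\<psi> j x = 2 / e * max 0 (e - dist x (c j))" for j x
  define T where "T i x = (\<Sum>j<i. \<psi> j x)" for i x
  define S where "S i x = min 1 (T i x)" for i x
  define \<phi> where "\<phi> i x = S (Suc i) x - S i x" for i x
  have \<psi>0: "0 \<le> \<psi> j x" for j x using e by (simp add: \<psi>_def)
  have \<psi>L: "(2 / e)-lipschitz_on UNIV (\<psi> j)" for j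
  proof (rule lipschitz_onI)
    fix x y
    have "\<bar>max 0 (e - dist x (c j)) - max 0 (e - dist y (c j))\<bar> \<le> dist x y"
      using dist_triangle[of x "c j" y] dist_triangle[of y "c j" x] dist_commute[of x y]
      by (auto simp: max_def)
    then have "2 / e * \<bar>max 0 (e - dist x (c j)) - max 0 (e - dist y (c j))\<bar> \<le> 2 / e * dist x y"
      using e by (intro mult_left_mono) auto
    moreover have "dist (\<psi> j x) (\<psi> j y) = 2 / e * \<bar>max 0 (e - dist x (c j)) - max 0 (e - dist y (c j))\<bar>"
      using e unfolding \<psi>_def dist_real_def right_diff_distrib[symmetric] abs_mult by simp
    ultimately show "dist (\<psi> j x) (\<psi> j y) \<le> 2 / e * dist x y" by simp
  qed (use e in simp)
  have TL: "\<exists>L. L-lipschitz_on UNIV (T i)" for i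
  proof (induction i)
    case 0
    have "0-lipschitz_on UNIV (T 0)" by (simp add: T_def lipschitz_on_def)
    then show ?case ..
  next
    case (Suc i)
    then obtain L where "L-lipschitz_on UNIV (T i)" ..
    from lipschitz_on_add[OF this \<psi>L] show ?case by (auto simp: T_def)
  qed
  have SL: "\<exists>L. L-lipschitz_on UNIV (S i)" for i
  proof -
    obtain L where L: "L-lipschitz_on UNIV (T i)" using TL ..
    have "dist (S i x) (S i y) \<le> dist (T i x) (T i y)" for x y
      by (auto simp: S_def dist_real_def min_def)
    then have "L-lipschitz_on UNIV (S i)"
      using L unfolding lipschitz_on_def by (meson order_trans)
    then show ?thesis ..
  qed
  have \<phi>L: "\<exists>L>0. L-lipschitz_on UNIV (\<phi> i)" for i
  proof -
    obtain L L' where "L-lipschitz_on UNIV (S (Suc i))" "L'-lipschitz_on UNIV (S i)" using SL by blast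
    from lipschitz_on_diff[OF this] have l: "(L + L')-lipschitz_on UNIV (\<phi> i)" by (simp add: \<phi>_def)
    \<comment> \<open>The extra 1 makes the constant strictly positive, as the estimates that divide
      by it demand.\<close>
    have "(L + L' + 1)-lipschitz_on UNIV (\<phi> i)" "L + L' + 1 > 0"
      using lipschitz_on_le[OF l] lipschitz_on_nonneg[OF l] by auto
    then show ?thesis by blast
  qed
  have sum: "(\<Sum>i<m. \<phi> i x) = S m x" for x
    unfolding \<phi>_def by (subst sum_lessThan_telescope) (simp add: S_def T_def)
  have supp: "dist x (c i) < e" if "\<phi> i x \<noteq> 0" for i x
  proof (rule ccontr)
    assume "\<not> ?thesis"
    then have "\<psi> i x = 0" by (simp add: \<psi>_def)
    then have "\<phi> i x = 0" by (simp add: \<phi>_def S_def T_def)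
    with that show False ..
  qed
  show ?thesis
  proof (rule that[of \<phi> m]; intro allI ballI impI)
    fix i show "\<exists>L>0. L-lipschitz_on UNIV (\<phi> i)" by (rule \<phi>L)
  next
    fix i x show "0 \<le> \<phi> i x"
      using \<psi>0[of i x] by (auto simp: \<phi>_def S_def T_def)
  next
    fix x show "(\<Sum>i<m. \<phi> i x) \<le> 1" by (simp add: sum S_def)
  next
    fix x assume "x \<in> K"
    then obtain j where j: "j < m" "dist (c j) x < e / 2" using C(3) c by auto
    have "1 \<le> \<psi> j x" using j(2) e by (auto simp: \<psi>_def dist_commute field_simps max_def)
    also have "\<dots> \<le> T m x" unfolding T_def using j(1) \<psi>0 by (intro member_le_sum) auto
    finally show "(\<Sum>i<m. \<phi> i x) = 1" by (simp add: sum S_def)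
  next
    fix i x y assume "\<phi> i x \<noteq> 0" "\<phi> i y \<noteq> 0"
    then show "norm (x - y) \<le> \<delta>"
      using supp[of i x] supp[of i y] dist_triangle2[of x y "c i"] by (simp add: e_def dist_norm)
  qed
qed

section \<open>Splitting off a fraction of a measure\<close>

lemma total_mass_add_measure_diff_le:
  assumes "M \<in> pos_measures" "R \<in> pos_measures"
  shows "total_mass (measure (add_measure M R) - measure M) \<le> measure R UNIV"
proof -
  have "decomposition (measure (add_measure M R) - measure M) R (null_measure borel)"
    using assms
    by (auto simp: decomposition_def measure_add_measure fun_eq_iff null_measure_pos_measures
        measure_def[of "null_measure _"])
  from total_mass_le[OF this] show ?thesis by (simp add: measure_def[of "null_measure _"])
qed

text \<open>\<open>J\<close> is the sum of the parts with densities \<open>\<theta>\<close> and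
  \<open>1 - \<theta>\<close>; the second one is what is left behind when only the first is
  transported.\<close>

lemma density_le_one:
  fixes J :: "'a::euclidean_space measure" and \<theta> :: "'a \<Rightarrow> real"
  assumes J: "J \<in> pos_measures" and \<theta>: "\<theta> \<in> borel_measurable borel" "\<And>x. 0 \<le> \<theta> x" "\<And>x. \<theta> x \<le> 1"
  shows "density J \<theta> \<in> pos_measures" "measure (density J \<theta>) UNIV = integral\<^sup>L J \<theta>"
    "total_mass (measure J - measure (density J \<theta>)) \<le> measure J UNIV - integral\<^sup>L J \<theta>"
proof -
  note sJ = pos_measuresD[OF J]
  \<comment> \<open>Needed twice, for \<open>\<theta>\<close> and for
    \<open>1 - \<theta>\<close>.\<close>
  have *: "density J f \<in> pos_measures \<and> measure (density J f) UNIV = integral\<^sup>L J f"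
    if f: "f \<in> borel_measurable borel" "\<And>x. 0 \<le> f x" "\<And>x. f x \<le> 1" for f :: "'a \<Rightarrow> real"
  proof -
    have fm: "f \<in> borel_measurable J" using f(1) by (simp add: measurable_cong_sets[OF sJ(1) refl])
    have "integrable J f"
      using f by (intro integrable_bounded_pos_measures[OF J, of f 1]) auto
    then have "emeasure (density J f) UNIV = ennreal (integral\<^sup>L J f)"
      using f sJ fm by (subst emeasure_density) (auto intro!: nn_integral_eq_integral)
    moreover have "0 \<le> integral\<^sup>L J f" using f by (intro integral_nonneg_AE) auto
    ultimately show ?thesis using sJ by (auto simp: pos_measures_def measure_def intro!: finite_measureI)
  qed
  define R where "R = density J (\<lambda>x. ennreal (1 - \<theta> x))"
  have R: "R \<in> pos_measures" "measure R UNIV = integral\<^sup>L J (\<lambda>x. 1 - \<theta> x)"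
    unfolding R_def using *[of "\<lambda>x. 1 - \<theta> x"] \<theta> by auto
  show D: "density J \<theta> \<in> pos_measures" "measure (density J \<theta>) UNIV = integral\<^sup>L J \<theta>"
    using *[OF \<theta>] by auto
  have \<theta>m: "\<theta> \<in> borel_measurable J" using \<theta>(1) by (simp add: measurable_cong_sets[OF sJ(1) refl])
  have eq: "J = add_measure (density J \<theta>) R"
  proof (rule measure_eqI)
    fix A assume A: "A \<in> sets J"
    have "emeasure J A = (\<integral>\<^sup>+x. ennreal (\<theta> x) * indicator A x + ennreal (1 - \<theta> x) * indicator A x \<partial>J)"
      using A \<theta> by (subst nn_integral_indicator[symmetric])
        (auto intro!: nn_integral_cong simp: distrib_right[symmetric] simp flip: ennreal_plus)
    also have "\<dots> = emeasure (add_measure (density J \<theta>) R) A"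
      using A \<theta>m by (simp add: emeasure_add_measure R_def emeasure_density nn_integral_add)
    finally show "emeasure J A = emeasure (add_measure (density J \<theta>) R) A" .
  qed simp
  have "integrable J \<theta>" using \<theta> by (intro integrable_bounded_pos_measures[OF J, of \<theta> 1]) auto
  then have "measure R UNIV = measure J UNIV - integral\<^sup>L J \<theta>"
    using R(2) sJ by (simp add: Bochner_Integration.integral_diff[OF finite_measure.integrable_const[OF sJ(3)]])
  then show "total_mass (measure J - measure (density J \<theta>)) \<le> measure J UNIV - integral\<^sup>L J \<theta>"
    using total_mass_add_measure_diff_le[OF D(1) R(1)] eq by simp
qed

text \<open>Integrates the kernel of the transport plan in one variable; the weights
  \<open>k i\<close> hold the factors in the other, frozen variable.\<close>

lemma sum_kernel_marginal:
  fixes J :: "'a::euclidean_space measure" and m :: nat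
  assumes J: "J \<in> pos_measures"
    and m: "\<And>i. \<phi> i \<in> borel_measurable borel" and b: "\<And>i x. 0 \<le> \<phi> i x" "\<And>i x. i < m \<Longrightarrow> \<phi> i x \<le> 1"
    and k: "\<And>i. 0 \<le> k i"
  shows "(\<integral>\<^sup>+y. ennreal (\<Sum>i<m. k i * \<phi> i y) \<partial>J) = ennreal (\<Sum>i<m. k i * integral\<^sup>L J (\<phi> i))"
proof -
  have i: "integrable J (\<phi> i)" if "i < m" for i
    using b m that by (intro integrable_bounded_pos_measures[OF J, of _ 1]) auto
  then have "(\<integral>y. (\<Sum>i<m. k i * \<phi> i y) \<partial>J) = (\<Sum>i<m. k i * integral\<^sup>L J (\<phi> i))"
    by (simp add: Bochner_Integration.integral_sum)
  moreover have "integrable J (\<lambda>y. \<Sum>i<m. k i * \<phi> i y)"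
    using i by (intro Bochner_Integration.integrable_sum) auto
  ultimately show ?thesis
    using b k by (subst nn_integral_eq_integral) (auto intro!: sum_nonneg AE_I2)
qed

text \<open>The plan moves, for each \<open>i\<close>, the mass common to \<open>\<phi> i J\<close> and \<open>\<phi> i J'\<close> independently inside the
  support of \<open>\<phi> i\<close>.\<close>

lemma W1ab_le_partition_of_unity:
  fixes J J' :: "'a::euclidean_space measure" and m :: nat
  assumes ab: "a > 0" "b > 0" and J: "J \<in> pos_measures" and J': "J' \<in> pos_measures"
    and m: "\<And>i. \<phi> i \<in> borel_measurable borel" and nn: "\<And>i x. 0 \<le> \<phi> i x"
    and le1: "\<And>x. (\<Sum>i<m. \<phi> i x) \<le> 1"
    and diam: "\<And>i x y. \<phi> i x \<noteq> 0 \<Longrightarrow> \<phi> i y \<noteq> 0 \<Longrightarrow> norm (x - y) \<le> \<delta>"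
    and \<delta>: "0 \<le> \<delta>"
    and s: "s = (\<Sum>i<m. min (integral\<^sup>L J (\<phi> i)) (integral\<^sup>L J' (\<phi> i)))"
  shows "W1ab a b J J' \<le> ennreal (a * (measure J UNIV - s + (measure J' UNIV - s)) + b * (\<delta> * s))"
proof -
  note sJ = pos_measuresD[OF J] and sJ' = pos_measuresD[OF J']
  note [measurable_cong] = sJ(1) sJ'(1) and [measurable] = m
  interpret J: finite_measure J by (rule sJ)
  interpret J': finite_measure J' by (rule sJ')
  interpret JJ: pair_sigma_finite J J' ..
  define p q where "p i = integral\<^sup>L J (\<phi> i)" and "q i = integral\<^sup>L J' (\<phi> i)" for i
  have pq: "0 \<le> p i" "0 \<le> q i" for i
    unfolding p_def q_def using nn by (auto intro!: integral_nonneg_AE)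
  define c where "c i = min (p i) (q i) / (p i * q i)" for i \<comment> \<open>\<open>0\<close> if \<open>p i * q i = 0\<close>\<close>
  have c0: "0 \<le> c i" for i using pq by (simp add: c_def)
  have cp: "c i * p i \<le> 1" and cq: "c i * q i \<le> 1" for i
    using pq[of i] by (auto simp: c_def divide_le_eq)
  have cpq: "c i * q i * p i = min (p i) (q i)" "c i * p i * q i = min (p i) (q i)" for i
    using pq[of i] by (auto simp: c_def)
  \<comment> \<open>Density of the plan relative to the product of \<open>J\<close> and
    \<open>J'\<close>. Block \<open>i\<close> is the product of \<open>\<phi> i J\<close> and
    \<open>\<phi> i J'\<close>, of mass \<open>p i * q i\<close>, rescaled by \<open>c i\<close> to
    the mass \<open>min (p i) (q i)\<close>.\<close>
  define \<kappa> where "\<kappa> z = (\<Sum>i<m. c i * \<phi> i (fst z) * \<phi> i (snd z))" for z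
  have \<kappa>0: "0 \<le> \<kappa> z" for z unfolding \<kappa>_def using c0 nn by (auto intro!: sum_nonneg)
  have [measurable]: "\<kappa> \<in> borel_measurable (J \<Otimes>\<^sub>M J')"
    unfolding \<kappa>_def by measurable
  have \<phi>1: "\<phi> i x \<le> 1" if "i < m" for i x
  proof (rule order_trans[OF _ le1])
    show "\<phi> i x \<le> (\<Sum>i<m. \<phi> i x)" using nn that by (intro member_le_sum) auto
  qed
  \<comment> \<open>\<open>\<theta>\<close> and \<open>\<theta>'\<close> are the fractions of
    \<open>J\<close> and \<open>J'\<close> that the plan moves. They stay below 1 since
    \<open>c i * q i\<close> and \<open>c i * p i\<close> do and the \<open>\<phi> i\<close> sum to
    at most 1.\<close>
  define \<theta> where "\<theta> x = (\<Sum>i<m. (c i * q i) * \<phi> i x)" for x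
  define \<theta>' where "\<theta>' y = (\<Sum>i<m. (c i * p i) * \<phi> i y)" for y
  have sub: "(\<lambda>x. \<Sum>i<m. k i * \<phi> i x) \<in> borel_measurable borel"
      "0 \<le> (\<Sum>i<m. k i * \<phi> i x)" "(\<Sum>i<m. k i * \<phi> i x) \<le> 1"
    if "\<And>i. 0 \<le> k i" "\<And>i. k i \<le> 1" for k :: "nat \<Rightarrow> real" and x
  proof -
    show "(\<lambda>x. \<Sum>i<m. k i * \<phi> i x) \<in> borel_measurable borel" by measurable
    show "0 \<le> (\<Sum>i<m. k i * \<phi> i x)" using that nn by (auto intro!: sum_nonneg)
    have "(\<Sum>i<m. k i * \<phi> i x) \<le> (\<Sum>i<m. \<phi> i x)"
      using that nn by (intro sum_mono mult_left_le_one_le) auto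
    with le1[of x] show "(\<Sum>i<m. k i * \<phi> i x) \<le> 1" by linarith
  qed
  have \<theta>: "\<theta> \<in> borel_measurable borel" "\<And>x. 0 \<le> \<theta> x" "\<And>x. \<theta> x \<le> 1"
    unfolding \<theta>_def using sub[of "\<lambda>i. c i * q i"] c0 pq cq by auto
  have \<theta>': "\<theta>' \<in> borel_measurable borel" "\<And>x. 0 \<le> \<theta>' x" "\<And>x. \<theta>' x \<le> 1"
    unfolding \<theta>'_def using sub[of "\<lambda>i. c i * p i"] c0 pq cp by auto
  note [measurable] = \<theta>(1) \<theta>'(1)
  have int: "integrable J (\<phi> i)" "integrable J' (\<phi> i)" if "i < m" for i
    using nn \<phi>1 that by (auto intro!: integrable_bounded_pos_measures[of _ _ 1] J J')
  have int\<theta>: "integral\<^sup>L J \<theta> = s" "integral\<^sup>L J' \<theta>' = s"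
    unfolding \<theta>_def \<theta>'_def using int
    by (simp_all add: Bochner_Integration.integral_sum cpq s flip: p_def q_def)
  define M N where "M = density J \<theta>" and "N = density J' \<theta>'"
  note M = density_le_one[OF J \<theta>, folded M_def, unfolded int\<theta>]
  note N = density_le_one[OF J' \<theta>', folded N_def, unfolded int\<theta>]
  define \<pi> where "\<pi> = density (J \<Otimes>\<^sub>M J') \<kappa>"
  have s\<pi>: "sets \<pi> = sets borel"
    unfolding \<pi>_def sets_density sets_pair_measure_cong[OF sJ(1) sJ'(1)] borel_prod ..
  have marg: "(\<integral>\<^sup>+y. ennreal (\<kappa> (x, y)) \<partial>J') = ennreal (\<theta> x)"
    "(\<integral>\<^sup>+x. ennreal (\<kappa> (x, y)) \<partial>J) = ennreal (\<theta>' y)" for x y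
    using sum_kernel_marginal[where \<phi> = \<phi> and m = m and k = "\<lambda>i. c i * \<phi> i x", OF J' m nn \<phi>1]
      sum_kernel_marginal[where \<phi> = \<phi> and m = m and k = "\<lambda>i. c i * \<phi> i y", OF J m nn \<phi>1] c0 nn
    by (simp_all add: \<kappa>_def \<theta>_def \<theta>'_def p_def q_def ac_simps)
  have [measurable]: "fst \<in> \<pi> \<rightarrow>\<^sub>M J" "snd \<in> \<pi> \<rightarrow>\<^sub>M J'" by (simp_all add: \<pi>_def)
  have fst: "distr \<pi> borel fst = M"
  proof (rule measure_eqI)
    fix A assume "A \<in> sets (distr \<pi> borel fst)"
    then have [measurable]: "A \<in> sets borel" by simp
    have "emeasure (distr \<pi> borel fst) A = (\<integral>\<^sup>+z. ennreal (\<kappa> z) * indicator A (fst z) \<partial>(J \<Otimes>\<^sub>M J'))"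
      by (subst nn_integral_indicator[symmetric], simp, subst nn_integral_distr)
        (simp_all add: \<pi>_def nn_integral_density)
    also have "\<dots> = (\<integral>\<^sup>+x. \<integral>\<^sup>+y. ennreal (\<kappa> (x, y)) * indicator A x \<partial>J' \<partial>J)"
      by (subst J'.nn_integral_fst[symmetric]) simp_all
    also have "\<dots> = (\<integral>\<^sup>+x. ennreal (\<theta> x) * indicator A x \<partial>J)"
      by (intro nn_integral_cong) (simp add: nn_integral_multc marg)
    also have "\<dots> = emeasure M A" by (simp add: M_def emeasure_density)
    finally show "emeasure (distr \<pi> borel fst) A = emeasure M A" .
  qed (simp add: M_def sJ)
  have snd: "distr \<pi> borel snd = N"
  proof (rule measure_eqI)
    fix A assume "A \<in> sets (distr \<pi> borel snd)"
    then have [measurable]: "A \<in> sets borel" by simp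
    have "emeasure (distr \<pi> borel snd) A = (\<integral>\<^sup>+z. ennreal (\<kappa> z) * indicator A (snd z) \<partial>(J \<Otimes>\<^sub>M J'))"
      by (subst nn_integral_indicator[symmetric], simp, subst nn_integral_distr)
        (simp_all add: \<pi>_def nn_integral_density)
    also have "\<dots> = (\<integral>\<^sup>+y. \<integral>\<^sup>+x. ennreal (\<kappa> (x, y)) * indicator A y \<partial>J \<partial>J')"
      by (subst JJ.nn_integral_snd[symmetric]) simp_all
    also have "\<dots> = (\<integral>\<^sup>+y. ennreal (\<theta>' y) * indicator A y \<partial>J')"
      by (intro nn_integral_cong) (simp add: nn_integral_multc marg)
    also have "\<dots> = emeasure N A" by (simp add: N_def emeasure_density)
    finally show "emeasure (distr \<pi> borel snd) A = emeasure N A" .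
  qed (simp add: N_def sJ')
  have s0: "0 \<le> s" unfolding s p_def[symmetric] q_def[symmetric] using pq by (auto intro!: sum_nonneg)
  have "W1 M N \<le> (\<integral>\<^sup>+ z. ennreal (norm (fst z - snd z)) \<partial>\<pi>)"
    unfolding W1_def using s\<pi> fst snd by (intro INF_lower) (simp add: couplings_def)
  also have "\<dots> = (\<integral>\<^sup>+ z. ennreal (\<kappa> z) * ennreal (norm (fst z - snd z)) \<partial>(J \<Otimes>\<^sub>M J'))"
    unfolding \<pi>_def by (subst nn_integral_density) simp_all
  also have "\<dots> \<le> (\<integral>\<^sup>+ z. ennreal \<delta> * ennreal (\<kappa> z) \<partial>(J \<Otimes>\<^sub>M J'))"
  proof (rule nn_integral_mono)
    fix z :: "'a \<times> 'a"
    \<comment> \<open>Either a factor vanishes or both points lie in the support of the same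
      \<open>\<phi> i\<close>.\<close>
    have *: "\<phi> i (fst z) * \<phi> i (snd z) * norm (fst z - snd z) \<le> \<phi> i (fst z) * \<phi> i (snd z) * \<delta>" for i
    proof (cases "\<phi> i (fst z) = 0 \<or> \<phi> i (snd z) = 0")
      case False
      then show ?thesis using diam nn by (intro mult_left_mono) auto
    qed auto
    have "\<kappa> z * norm (fst z - snd z) \<le> \<kappa> z * \<delta>"
      unfolding \<kappa>_def sum_distrib_right
      by (rule sum_mono) (use mult_left_mono[OF * c0] in \<open>simp add: mult.assoc\<close>)
    then show "ennreal (\<kappa> z) * ennreal (norm (fst z - snd z)) \<le> ennreal \<delta> * ennreal (\<kappa> z)"
      using \<kappa>0 \<delta> by (simp add: mult.commute flip: ennreal_mult)
  qed
  also have "\<dots> = ennreal \<delta> * (\<integral>\<^sup>+x. \<integral>\<^sup>+y. ennreal (\<kappa> (x, y)) \<partial>J' \<partial>J)"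
    by (subst nn_integral_cmult, simp, subst J'.nn_integral_fst[symmetric]) simp_all
  also have "\<dots> = ennreal \<delta> * ennreal s"
    unfolding marg using integrable_bounded_pos_measures[OF J \<theta>(1), of 1] \<theta>
    by (subst nn_integral_eq_integral) (simp_all add: int\<theta>)
  finally have W: "W1 M N \<le> ennreal (\<delta> * s)" using \<delta> s0 by (simp add: ennreal_mult)
  \<comment> \<open>The moved parts form the competitor; the remaining mass on either side is paid
    for at rate \<open>a\<close>.\<close>
  have "W1ab a b J J' \<le> ennreal (a * (total_mass (measure J - measure M) + total_mass (measure J' - measure N)))
      + ennreal b * W1 M N"
    unfolding W1ab_def using M N by (intro INF_lower2[of "(M, N)"]) auto
  also have "\<dots> \<le> ennreal (a * (measure J UNIV - s + (measure J' UNIV - s))) + ennreal b * ennreal (\<delta> * s)"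
    using ab M(3) N(3) W by (intro add_mono ennreal_leI mult_left_mono) auto
  also have "\<dots> = ennreal (a * (measure J UNIV - s + (measure J' UNIV - s)) + b * (\<delta> * s))"
    using ab \<delta> s0 order_trans[OF total_mass_nonneg M(3)] order_trans[OF total_mass_nonneg N(3)]
    by (simp flip: ennreal_mult ennreal_plus)
  finally show ?thesis .
qed

subsection \<open>Coding points of Euclidean space by real numbers\<close>

text \<open>At the first differing digit \<open>k\<close> the terms differ by
  \<open>(1/3) ^ Suc k\<close>, and the later digits, being 0 or 1, can undo at most half of this.
  Base 3 thus excludes the ambiguity of binary expansions, where a tail can compensate a digit
  completely.\<close>

lemma ternary_bits_agree:
  fixes u v :: "nat \<Rightarrow> bool"
  assumes "\<bar>(\<Sum>j. of_bool (u j) / 3 ^ Suc j) - (\<Sum>j. of_bool (v j) / 3 ^ Suc j :: real)\<bar> < (1 / 2) / 3 ^ J" "j < J"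
  shows "u j = v j"
proof (rule ccontr)
  define f g :: "nat \<Rightarrow> real" where "f j = of_bool (u j) / 3 ^ Suc j" and "g j = of_bool (v j) / 3 ^ Suc j" for j
  have geo: "(\<lambda>j. (1 / 3 :: real) ^ Suc j) sums (1 / 2)"
    using sums_mult[OF geometric_sums[of "1/3::real"], of "1/3"] by simp
  have sf: "summable f" "summable g"
    unfolding f_def g_def
    by (auto intro!: summable_comparison_test'[OF sums_summable[OF geo], of 0] simp: power_one_over field_simps of_bool_def)
  assume "\<not> ?thesis"
  then have "\<exists>j. j < J \<and> u j \<noteq> v j" using assms by blast
  \<comment> \<open>The least position of disagreement, so that all earlier terms cancel.\<close>
  then obtain k where k: "k < J" "u k \<noteq> v k" "\<And>i. i < k \<Longrightarrow> u i = v i"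
    using exists_least_iff[of "\<lambda>j. j < J \<and> u j \<noteq> v j"] by (meson order.strict_trans)
  define h where "h j = f j - g j" for j
  have sh: "summable h" unfolding h_def by (intro summable_diff sf)
  have h: "\<bar>h j\<bar> \<le> (1 / 3) ^ Suc j" for j
    by (auto simp: h_def f_def g_def power_one_over of_bool_def)
  have "suminf h = (\<Sum>j<Suc k. h j) + (\<Sum>j. h (j + Suc k))"
    using suminf_split_initial_segment[OF sh, of "Suc k"] by simp
  also have "(\<Sum>j<Suc k. h j) = h k" using k(3) by (simp add: h_def f_def g_def)
  finally have e: "suminf h = h k + (\<Sum>j. h (j + Suc k))" .
  have "\<bar>h k\<bar> = (1 / 3) ^ Suc k"
    using k(2) by (auto simp: h_def f_def g_def power_one_over of_bool_def)
  moreover have "\<bar>\<Sum>j. h (j + Suc k)\<bar> \<le> (1 / 3) ^ Suc k * (1 / 2)"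
  proof -
    have tail: "(\<lambda>j. (1 / 3 :: real) ^ Suc k * (1 / 3) ^ Suc j) sums ((1 / 3) ^ Suc k * (1 / 2))"
      by (rule sums_mult[OF geo])
    have "norm (\<Sum>j. h (j + Suc k)) \<le> (\<Sum>j. (1 / 3 :: real) ^ Suc k * (1 / 3) ^ Suc j)"
    proof (rule norm_suminf_le[OF _ sums_summable[OF tail]])
      fix j show "norm (h (j + Suc k)) \<le> (1 / 3) ^ Suc k * (1 / 3) ^ Suc j"
        using h[of "j + Suc k"] by (simp add: power_add ac_simps)
    qed
    then show ?thesis using sums_unique[OF tail] by simp
  qed
  ultimately have "(1 / 3) ^ Suc k * (1 / 2) \<le> \<bar>suminf h\<bar>" using e by linarith
  moreover have "(1 / 3 :: real) ^ J \<le> (1 / 3) ^ Suc k" using k(1) by (intro power_decreasing) auto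
  moreover have "suminf h = suminf f - suminf g" unfolding h_def using suminf_diff[OF sf] by simp
  ultimately show False using assms(1) unfolding f_def[symmetric] g_def[symmetric]
    by (simp add: power_one_over)
qed

text \<open>Doubling appends one binary digit: \<open>\<lfloor>2 * z\<rfloor>\<close> is twice
  \<open>\<lfloor>z\<rfloor>\<close> plus a parity bit.\<close>

lemma floor_double_eqI:
  fixes x y :: real
  assumes "\<lfloor>x\<rfloor> = \<lfloor>y\<rfloor>" "odd \<lfloor>2 * x\<rfloor> = odd \<lfloor>2 * y\<rfloor>"
  shows "\<lfloor>2 * x\<rfloor> = \<lfloor>2 * y\<rfloor>"
proof -
  have "\<lfloor>2 * z\<rfloor> = 2 * \<lfloor>z\<rfloor> \<or> \<lfloor>2 * z\<rfloor> = 2 * \<lfloor>z\<rfloor> + 1" for z :: real by linarith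
  from this[of x] this[of y] assms show ?thesis by auto
qed

text \<open>The integer part of the code lists the integer parts of the coordinates, the ternary digits
  of its fractional part are the binary digits of the coordinates.\<close>

lemma euclidean_space_real_code:
  obtains s :: "'a::euclidean_space \<Rightarrow> real" and h :: "real \<Rightarrow> 'a" where
    "s \<in> borel_measurable borel" "continuous_on UNIV h" "\<forall>x. h (s x) = x"
    "\<forall>K. bounded K \<longrightarrow> bounded (s ` K)"
proof -
  define e where "e = from_nat_into ((Basis :: 'a set) \<times> (UNIV :: nat set))"
  have e: "range e = Basis \<times> UNIV"
    unfolding e_def by (intro range_from_nat_into countable_SIGMA) (auto intro: countable_finite)
  define F where "F x = (\<lambda>b\<in>Basis. \<lfloor>x \<bullet> b\<rfloor>)" for x :: 'a
  define Z where "Z = (Basis :: 'a set) \<rightarrow>\<^sub>E (UNIV :: int set)"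
  have Z: "countable Z" unfolding Z_def by (intro countable_PiE) auto
  have FZ: "F x \<in> Z" for x by (simp add: F_def Z_def)
  define T where "T x = to_nat_on Z (F x)" for x
  have Teq: "F x = F y" if "T x = T y" for x y
    using that inj_on_to_nat_on[OF Z] FZ by (auto simp: T_def inj_on_def)
  \<comment> \<open>With \<open>e j = (b, i)\<close> this is the binary digit number
    \<open>Suc i\<close> after the point of the coordinate along \<open>b\<close>; \<open>e\<close>
    interleaves the digits of all coordinates.\<close>
  define bit where "bit j x = odd \<lfloor>2 ^ Suc (snd (e j)) * (x \<bullet> fst (e j))\<rfloor>" for j x
  define t where "t x = (\<Sum>j. of_bool (bit j x) / 3 ^ Suc j :: real)" for x
  define s where "s x = real (T x) + t x" for x
  have geo: "(\<lambda>j. (1 / 3 :: real) ^ Suc j) sums (1 / 2)"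
    using sums_mult[OF geometric_sums[of "1/3::real"], of "1/3"] by simp
  have st: "summable (\<lambda>j. of_bool (bit j x) / 3 ^ Suc j :: real)" for x
    by (rule summable_comparison_test'[OF sums_summable[OF geo], of 0]) (simp add: power_one_over)
  have t0: "0 \<le> t x" for x unfolding t_def by (intro suminf_nonneg st) simp
  \<comment> \<open>The bound \<open>1 / 2\<close> leaves gaps between codes with different integer
    parts.\<close>
  have t1: "t x \<le> 1 / 2" for x
    unfolding t_def sums_unique[OF geo] by (intro suminf_le st sums_summable[OF geo]) (simp add: power_one_over)

  have Fm: "F \<in> borel \<rightarrow>\<^sub>M count_space Z"
    unfolding measurable_count_space_eq_countable[OF Z]
  proof (intro conjI ballI)
    show "F \<in> space borel \<rightarrow> Z" using FZ by simp
    fix f assume f: "f \<in> Z"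
    have "F -` {f} \<inter> space borel = {x. \<forall>b\<in>Basis. \<lfloor>x \<bullet> b\<rfloor> = f b}"
      using f by (auto simp: F_def Z_def fun_eq_iff PiE_iff extensional_def)
    also have "\<dots> = (\<Inter>b\<in>Basis. {x. \<lfloor>x \<bullet> b\<rfloor> = f b})" by auto
    also have "\<dots> \<in> sets borel"
      by (intro sets.finite_INT) (auto simp: pred_def[symmetric])
    finally show "F -` {f} \<inter> space borel \<in> sets borel" .
  qed
  have Tm: "(\<lambda>x. real (T x)) \<in> borel_measurable borel"
    unfolding T_def by (rule measurable_compose_countable'[OF _ Fm Z]) simp
  have tm: "t \<in> borel_measurable borel"
    unfolding t_def bit_def by measurable
  have sm: "s \<in> borel_measurable borel"
    unfolding s_def using Tm tm by measurable

  \<comment> \<open>A bounded set meets only finitely many integer cells, so \<open>T\<close> is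
    bounded on it.\<close>
  have sb: "bounded (s ` K)" if K: "bounded K" for K
  proof -
    obtain B where B: "\<And>x. x \<in> K \<Longrightarrow> norm x \<le> B" using K by (auto simp: bounded_iff)
    define A where "A = (Basis :: 'a set) \<rightarrow>\<^sub>E {-\<lceil>B\<rceil> - 1 .. \<lceil>B\<rceil>}"
    have "finite A" unfolding A_def by (intro finite_PiE) auto
    have "F x \<in> A" if "x \<in> K" for x
    proof -
      have "-\<lceil>B\<rceil> - 1 \<le> \<lfloor>x \<bullet> b\<rfloor> \<and> \<lfloor>x \<bullet> b\<rfloor> \<le> \<lceil>B\<rceil>" if b: "b \<in> Basis" for b
      proof -
        have "-B \<le> x \<bullet> b" "x \<bullet> b \<le> B"
          using Basis_le_norm[OF b, of x] B[OF \<open>x \<in> K\<close>] by linarith+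
        then show ?thesis by linarith
      qed
      then show ?thesis by (auto simp: F_def A_def)
    qed
    then have "T ` K \<subseteq> to_nat_on Z ` A" by (auto simp: T_def)
    then have "finite (T ` K)" using \<open>finite A\<close> finite_surj by blast
    then obtain m where m: "\<And>x. x \<in> K \<Longrightarrow> T x \<le> m"
      using finite_nat_set_iff_bounded_le by auto
    have "norm (s x) \<le> real m + 1 / 2" if "x \<in> K" for x
      using m[OF that] t0[of x] t1[of x] unfolding s_def by simp
    then show ?thesis by (auto simp: bounded_iff)
  qed

  \<comment> \<open>Uniform continuity of the inverse of \<open>s\<close>, phrased before
    injectivity is known; injectivity then follows from it.\<close>
  have close: "\<exists>\<eta>>0. \<forall>x y. \<bar>s x - s y\<bar> < \<eta> \<longrightarrow> dist x y < \<epsilon>" if \<epsilon>: "\<epsilon> > 0" for \<epsilon>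
  proof -
    obtain k where k: "(1 / 2) ^ k < \<epsilon> / DIM('a)"
      using real_arch_pow_inv[of "\<epsilon> / DIM('a)" "1 / 2"] \<epsilon> by auto
    have "\<forall>z\<in>(Basis :: 'a set) \<times> {..<k}. \<exists>j. e j = z"
      using e by (metis SigmaE SigmaI UNIV_I rangeE)
    then obtain c where c: "\<And>z. z \<in> (Basis :: 'a set) \<times> {..<k} \<Longrightarrow> e (c z) = z" by metis
    \<comment> \<open>Beyond every position that codes one of the first \<open>k\<close> digits of
      some coordinate; \<open>insert 0\<close> keeps \<open>Max\<close> meaningful for
      \<open>k = 0\<close>.\<close>
    define J where "J = Suc (Max (insert 0 (c ` (Basis \<times> {..<k}))))"
    have cJ: "c z < J" if "z \<in> Basis \<times> {..<k}" for z
      unfolding J_def using that by (intro le_imp_less_Suc Max_ge) auto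
    show ?thesis
    proof (intro exI[of _ "(1 / 2) / 3 ^ J"] conjI allI impI)
      show "0 < (1 / 2) / (3 :: real) ^ J" by simp
      fix x y :: 'a assume xy: "\<bar>s x - s y\<bar> < (1 / 2) / 3 ^ J"
      have "(1 / 2) / 3 ^ J \<le> (1 / 2 :: real)" by (simp add: divide_le_eq)
      then have "\<bar>real (T x) - real (T y)\<bar> < 1"
        using xy t0[of x] t0[of y] t1[of x] t1[of y] unfolding s_def by linarith
      then have T: "T x = T y" by linarith
      then have "\<bar>t x - t y\<bar> < (1 / 2) / 3 ^ J" using xy by (simp add: s_def)
      then have bits: "bit j x = bit j y" if "j < J" for j
        unfolding t_def by (rule ternary_bits_agree[of "\<lambda>j. bit j x" "\<lambda>j. bit j y", OF _ that])
      \<comment> \<open>Digit by digit from the integer parts; at \<open>i = k\<close> the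
        coordinates scaled by \<open>2 ^ k\<close> share their floor and hence differ by at most
        1.\<close>
      have fl: "\<lfloor>2 ^ i * (x \<bullet> b)\<rfloor> = \<lfloor>2 ^ i * (y \<bullet> b)\<rfloor>" if b: "b \<in> Basis" and "i \<le> k" for b i
        using that(2)
      proof (induction i)
        case 0
        have "F x b = F y b" using Teq[OF T] by simp
        then show ?case using b by (simp add: F_def)
      next
        case (Suc i)
        then have z: "(b, i) \<in> Basis \<times> {..<k}" using b by simp
        show ?case
          using Suc bits[OF cJ[OF z]] c[OF z]
            floor_double_eqI[of "2 ^ i * (x \<bullet> b)" "2 ^ i * (y \<bullet> b)"]
          by (simp add: bit_def mult.assoc)
      qed
      have "\<bar>(x - y) \<bullet> b\<bar> \<le> (1 / 2) ^ k" if b: "b \<in> Basis" for b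
      proof -
        have "\<bar>2 ^ k * (x \<bullet> b) - 2 ^ k * (y \<bullet> b)\<bar> \<le> 1" using fl[OF b order_refl] by linarith
        then have "2 ^ k * \<bar>(x - y) \<bullet> b\<bar> \<le> 1"
          by (simp add: inner_diff_left abs_mult flip: right_diff_distrib)
        then show ?thesis by (simp add: power_one_over field_simps)
      qed
      then have "norm (x - y) \<le> (\<Sum>b\<in>(Basis :: 'a set). (1 / 2) ^ k)"
        by (intro order_trans[OF norm_le_l1] sum_mono) auto
      also have "\<dots> < \<epsilon>" using k by (simp add: field_simps)
      finally show "dist x y < \<epsilon>" by (simp add: dist_norm)
    qed
  qed
  have inj: "inj s"
  proof (rule injI, rule ccontr)
    fix x y :: 'a assume "s x = s y" "x \<noteq> y"
    from \<open>x \<noteq> y\<close> obtain \<eta> where \<eta>: "\<eta> > 0" "\<forall>x' y'. \<bar>s x' - s y'\<bar> < \<eta> \<longrightarrow> dist x' y' < dist x y"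
      using close[of "dist x y"] by auto
    from \<eta>(2)[rule_format, of x y] \<eta>(1) \<open>s x = s y\<close> show False by simp
  qed
  have "uniformly_continuous_on (range s) (inv s)"
    unfolding uniformly_continuous_on_def
  proof (intro allI impI)
    fix \<epsilon> :: real assume "\<epsilon> > 0"
    then obtain \<eta> where \<eta>: "\<eta> > 0" "\<forall>x y. \<bar>s x - s y\<bar> < \<eta> \<longrightarrow> dist x y < \<epsilon>" using close by blast
    then show "\<exists>d>0. \<forall>u\<in>range s. \<forall>v\<in>range s. dist v u < d \<longrightarrow> dist (inv s v) (inv s u) < \<epsilon>"
      using inj by (intro exI[of _ \<eta>]) (simp add: dist_real_def)
  qed
  \<comment> \<open>The limit measure on the line may charge points outside \<open>range s\<close>,
    so the inverse is extended to the closure by uniform continuity and then to the whole line by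
    Tietze.\<close>
  from uniformly_continuous_on_extension_on_closure[OF this]
  obtain g where g: "uniformly_continuous_on (closure (range s)) g" "\<And>u. u \<in> range s \<Longrightarrow> inv s u = g u" by metis
  obtain h where h: "continuous_on UNIV h" "\<And>u. u \<in> closure (range s) \<Longrightarrow> h u = g u"
    using Tietze_unbounded[OF uniformly_continuous_imp_continuous[OF g(1)], of UNIV] by auto
  have hs: "h (s x) = x" for x
  proof -
    have "s x \<in> closure (range s)" by (rule closure_subset[THEN subsetD]) simp
    then show ?thesis using h(2) g(2)[of "s x"] inj by simp
  qed
  show ?thesis by (rule that[OF sm h(1)]) (use hs sb in auto)
qed

subsection \<open>Compactness of tight sequences\<close>

text \<open>Narrow convergence: constants are admissible test functions, so the total mass passes to
  the limit.\<close>

definition weakly_converges :: "(nat \<Rightarrow> 'a::euclidean_space measure) \<Rightarrow> 'a measure \<Rightarrow> bool" where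
  "weakly_converges M L \<longleftrightarrow>
     (\<forall>\<phi> B. continuous_on UNIV \<phi> \<longrightarrow> (\<forall>x. \<bar>\<phi> x\<bar> \<le> (B::real)) \<longrightarrow>
       (\<lambda>n. integral\<^sup>L (M n) \<phi>) \<longlonglongrightarrow> integral\<^sup>L L \<phi>)"

text \<open>The images under \<open>s\<close> are tight because \<open>s\<close> maps bounded sets
  to bounded sets, and Helly gives a limit \<open>M\<close> on the line, which \<open>h\<close>
  carries back. Although \<open>s\<close> need not be continuous, \<open>\<phi> \<circ> h\<close>
  is, and \<open>h (s x) = x\<close> turns its integrals into those of
  \<open>\<phi>\<close>.\<close>

lemma tight_prob_convergent_subsequence:
  fixes p :: "nat \<Rightarrow> 'a::euclidean_space measure"
  assumes p: "\<And>n. p n \<in> pos_measures" "\<And>n. measure (p n) UNIV = 1" and t: "tight_pos p"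
  obtains r L where "strict_mono (r :: nat \<Rightarrow> nat)" "L \<in> pos_measures"
    "weakly_converges (p \<circ> r) L"
proof -
  obtain s :: "'a \<Rightarrow> real" and h where sm0: "s \<in> borel_measurable borel"
    and h: "continuous_on UNIV h" and "\<forall>x. h (s x) = x" "\<forall>K. bounded K \<longrightarrow> bounded (s ` K)"
    by (rule euclidean_space_real_code)
  then have hs: "h (s x) = x" and sb: "bounded K \<Longrightarrow> bounded (s ` K)" for x K by auto
  note [measurable] = sm0
  note sp = pos_measuresD[OF p(1)]
  have sm: "s \<in> p n \<rightarrow>\<^sub>M borel" for n by (simp add: measurable_cong_sets[OF sp(1) refl])
  define \<rho> where "\<rho> n = distr (p n) borel s" for n
  have rd: "real_distribution (\<rho> n)" for n
  proof -
    interpret finite_measure "p n" by (rule sp)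
    have "prob_space (p n)" using p(2)[of n] sp(2)[of n] by (intro prob_spaceI) (simp add: emeasure_eq_measure)
    then have "prob_space (\<rho> n)" unfolding \<rho>_def by (rule prob_space.prob_space_distr) (rule sm)
    then show ?thesis by (simp add: real_distribution_def real_distribution_axioms_def \<rho>_def)
  qed
  have "tight \<rho>"
    unfolding tight_def
  proof (intro conjI allI impI rd)
    fix \<epsilon> :: real assume "\<epsilon> > 0"
    then obtain K where K: "compact K" "\<And>n. measure (p n) (UNIV - K) < \<epsilon>"
      using t unfolding tight_pos_def by blast
    obtain B where B: "\<And>x. x \<in> K \<Longrightarrow> \<bar>s x\<bar> \<le> B"
      using sb[OF compact_imp_bounded[OF K(1)]] by (auto simp: bounded_iff)
    \<comment> \<open>The added 1 gives the strict lower end of the half-open interval, and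
      \<open>max B 0\<close> makes the interval nonempty even when \<open>K\<close> is
      empty.\<close>
    define C where "C = max B 0 + 1"
    have C: "C > 0" "\<And>x. x \<in> K \<Longrightarrow> s x \<in> {-C<..C}"
      using B by (force simp: C_def abs_le_iff max_def)+
    have Kb: "K \<in> sets borel" using K(1) by (simp add: borel_compact)
    have "measure (\<rho> n) {-C<..C} > 1 - \<epsilon>" for n
    proof -
      interpret finite_measure "p n" by (rule sp)
      have "measure (p n) (UNIV - K) = 1 - measure (p n) K"
        using finite_measure_compl[of K] Kb p(2)[of n] sp(1,2)[of n] by simp
      moreover have "measure (p n) K \<le> measure (p n) (s -` {-C<..C})"
        using C sp(1)[of n] by (intro finite_measure_mono) (auto intro!: measurable_sets_borel[OF sm0])
      moreover have "measure (\<rho> n) {-C<..C} = measure (p n) (s -` {-C<..C})"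
        unfolding \<rho>_def using sp(2)[of n] by (subst measure_distr[OF sm]) auto
      ultimately show ?thesis using K(2)[of n] by linarith
    qed
    then show "\<exists>a b. a < b \<and> (\<forall>n. measure (\<rho> n) {a<..b} > 1 - \<epsilon>)"
      using C(1) by (intro exI[of _ "-C"] exI[of _ C]) auto
  qed
  then obtain r M where r: "strict_mono (r :: nat \<Rightarrow> nat)" and M: "real_distribution M"
    and wc: "weak_conv_m (\<rho> \<circ> r) M"
    using tight_imp_convergent_subsubsequence[of \<rho> id] strict_mono_id by auto
  interpret M: real_distribution M by (rule M)
  define L where "L = distr M borel h"
  have hm: "h \<in> borel_measurable borel" by (intro borel_measurable_continuous_onI h)
  then have hM: "h \<in> M \<rightarrow>\<^sub>M borel" by simp
  have "finite_measure L" unfolding L_def by (rule M.finite_measure_distr) (rule hM)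
  then have L: "L \<in> pos_measures" by (simp add: pos_measures_def L_def)
  show ?thesis
  proof (rule that[OF r L], unfold weakly_converges_def, intro allI impI)
    fix \<phi> :: "'a \<Rightarrow> real" and B
    assume \<phi>: "continuous_on UNIV \<phi>" "\<forall>x. \<bar>\<phi> x\<bar> \<le> B"
    have \<phi>m: "\<phi> \<in> borel_measurable borel" by (intro borel_measurable_continuous_onI \<phi>)
    have c: "isCont (\<lambda>u. \<phi> (h u)) u" for u
      using continuous_on_compose2[OF \<phi>(1) h] by (auto simp: continuous_on_eq_continuous_at)
    have "(\<lambda>n. integral\<^sup>L ((\<rho> \<circ> r) n) (\<lambda>u. \<phi> (h u))) \<longlonglongrightarrow> integral\<^sup>L M (\<lambda>u. \<phi> (h u))"
      by (rule weak_conv_imp_integral_bdd_continuous_conv[OF _ M wc, where B = B]) (use rd c \<phi>(2) in auto)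
    moreover have "integral\<^sup>L (\<rho> n) (\<lambda>u. \<phi> (h u)) = integral\<^sup>L (p n) \<phi>" for n
      unfolding \<rho>_def using hm \<phi>m by (subst integral_distr[OF sm]) (auto simp: hs intro: measurable_compose)
    moreover have "integral\<^sup>L M (\<lambda>u. \<phi> (h u)) = integral\<^sup>L L \<phi>"
      unfolding L_def by (rule integral_distr[OF hM \<phi>m, symmetric])
    ultimately show "(\<lambda>n. integral\<^sup>L ((p \<circ> r) n) \<phi>) \<longlonglongrightarrow> integral\<^sup>L L \<phi>" by simp
  qed
qed

lemma scale_pos_measures:
  fixes M :: "'a::euclidean_space measure"
  assumes M: "M \<in> pos_measures" and c: "0 \<le> c"
  defines "S \<equiv> scale_measure (ennreal c) M"
  shows "S \<in> pos_measures" "measure S A = c * measure M A" "\<phi> \<in> borel_measurable borel \<Longrightarrow> integral\<^sup>L S \<phi> = c * integral\<^sup>L M (\<phi> :: 'a \<Rightarrow> real)"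
proof -
  note sM = pos_measuresD[OF M]
  interpret finite_measure M by (rule sM)
  have "finite_measure S"
    by (rule finite_measureI) (use sM in \<open>auto simp: S_def emeasure_eq_measure simp flip: ennreal_mult''\<close>)
  then show "S \<in> pos_measures" using sM by (simp add: pos_measures_def S_def)
  show "measure S A = c * measure M A" using c by (simp add: S_def)
  have "S = density M (\<lambda>_. ennreal c)"
    by (rule measure_eqI) (auto simp: S_def emeasure_density nn_integral_cmult)
  then show "integral\<^sup>L S \<phi> = c * integral\<^sup>L M \<phi>" if \<phi>: "\<phi> \<in> borel_measurable borel"
    using c \<phi> sM by (simp add: integral_real_density measurable_cong_sets[OF sM(1) refl])
qed

text \<open>The masses converge to some \<open>c\<close> along a subsequence. If
  \<open>c = 0\<close> the limit is the null measure; otherwise normalize to probabilities and scale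
  their limit by \<open>c\<close>.\<close>

lemma tight_convergent_subsequence:
  fixes M :: "nat \<Rightarrow> 'a::euclidean_space measure"
  assumes M: "\<And>n. M n \<in> pos_measures" and C: "\<And>n. measure (M n) UNIV \<le> C" and t: "tight_pos M"
  obtains r L where "strict_mono (r :: nat \<Rightarrow> nat)" "L \<in> pos_measures"
    "weakly_converges (M \<circ> r) L"
proof -
  define mass where "mass n = measure (M n) UNIV" for n
  have "bounded (range mass)"
    using C by (auto simp: bounded_iff mass_def intro!: exI[of _ C])
  then obtain c r where r: "strict_mono (r :: nat \<Rightarrow> nat)" and c: "(\<lambda>n. mass (r n)) \<longlonglongrightarrow> c"
    using bounded_imp_convergent_subsequence[of mass] by (auto simp: o_def)
  have "0 \<le> c" by (rule LIMSEQ_le_const[OF c]) (auto simp: mass_def)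
  then consider "c = 0" | "c > 0" by linarith
  then show ?thesis
  proof cases
    case 1
    show ?thesis
    proof (rule that[OF r null_measure_pos_measures], unfold weakly_converges_def, intro allI impI)
      fix \<phi> :: "'a \<Rightarrow> real" and B
      assume \<phi>: "continuous_on UNIV \<phi>" "\<forall>x. \<bar>\<phi> x\<bar> \<le> B"
      have "\<forall>\<^sub>F n in sequentially. norm (integral\<^sup>L (M (r n)) \<phi>) \<le> B * mass (r n)"
        using abs_integral_le_pos_measures[OF M borel_measurable_continuous_onI[OF \<phi>(1)] \<phi>(2)[rule_format]]
        by (simp add: mass_def)
      moreover have "(\<lambda>n. B * mass (r n)) \<longlonglongrightarrow> 0"
        using tendsto_mult_right_zero[of "\<lambda>n. mass (r n)"] c 1 by simp
      ultimately have "(\<lambda>n. integral\<^sup>L (M (r n)) \<phi>) \<longlonglongrightarrow> 0"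
        by (rule Lim_null_comparison)
      moreover have "integral\<^sup>L (null_measure borel) \<phi> = 0"
        by (simp add: integral_null_measure)
      ultimately show "(\<lambda>n. integral\<^sup>L ((M \<circ> r) n) \<phi>) \<longlonglongrightarrow> integral\<^sup>L (null_measure borel) \<phi>" by simp
    qed
  next
    case 2
    then have "eventually (\<lambda>n. mass (r n) > c / 2) sequentially"
      using c by (intro order_tendstoD) auto
    then obtain N where N: "\<And>n. n \<ge> N \<Longrightarrow> mass (r n) > c / 2" by (auto simp: eventually_sequentially)
    \<comment> \<open>The shift gives masses above \<open>c / 2\<close> for every index, so division
      by them preserves tightness: tails below \<open>\<epsilon> * (c / 2)\<close> become tails
      below \<open>\<epsilon>\<close>.\<close>
    define r' where "r' n = r (n + N)" for n
    have r': "strict_mono r'" using r by (auto simp: r'_def strict_mono_def)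
    have mr: "mass (r' n) > c / 2" for n unfolding r'_def by (rule N) simp
    have mp: "mass (r' n) > 0" for n using mr[of n] 2 by linarith
    have c': "(\<lambda>n. mass (r' n)) \<longlonglongrightarrow> c" unfolding r'_def by (rule LIMSEQ_ignore_initial_segment[OF c])
    define p where "p n = scale_measure (ennreal (1 / mass (r' n))) (M (r' n))" for n
    have p: "p n \<in> pos_measures" "measure (p n) A = measure (M (r' n)) A / mass (r' n)"
      "\<phi> \<in> borel_measurable borel \<Longrightarrow> integral\<^sup>L (M (r' n)) \<phi> = mass (r' n) * integral\<^sup>L (p n) \<phi>" for n A and \<phi> :: "'a \<Rightarrow> real"
      unfolding p_def using mp[of n] by (simp_all add: scale_pos_measures[OF M])
    have tp: "tight_pos p"
      unfolding tight_pos_def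
    proof (intro allI impI)
      fix \<epsilon> :: real assume "\<epsilon> > 0"
      then have "\<epsilon> * (c / 2) > 0" using 2 by simp
      then obtain K where K: "compact K" "\<And>n. measure (M n) (UNIV - K) < \<epsilon> * (c / 2)"
        using t unfolding tight_pos_def by blast
      have "measure (p n) (UNIV - K) < \<epsilon>" for n
      proof -
        have "\<epsilon> * (c / 2) \<le> \<epsilon> * mass (r' n)" using mr[of n] \<open>\<epsilon> > 0\<close> by (intro mult_left_mono) auto
        then show ?thesis using K(2)[of "r' n"] mp[of n] by (simp add: p(2) pos_divide_less_eq)
      qed
      with K(1) show "\<exists>K. compact K \<and> (\<forall>n. measure (p n) (UNIV - K) < \<epsilon>)" by blast
    qed
    have one: "measure (p n) UNIV = 1" for n using mp[of n] by (simp add: p(2) mass_def)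
    obtain q L where q: "strict_mono (q :: nat \<Rightarrow> nat)" and L: "L \<in> pos_measures"
      and lim: "weakly_converges (p \<circ> q) L"
      by (rule tight_prob_convergent_subsequence[OF p(1) one tp])
    note S = scale_pos_measures[OF L \<open>0 \<le> c\<close>]
    show ?thesis
    proof (rule that[OF strict_mono_o[OF r' q] S(1)], unfold weakly_converges_def, intro allI impI)
      fix \<phi> :: "'a \<Rightarrow> real" and B
      assume \<phi>: "continuous_on UNIV \<phi>" "\<forall>x. \<bar>\<phi> x\<bar> \<le> B"
      have "(\<lambda>n. mass (r' (q n)) * integral\<^sup>L (p (q n)) \<phi>) \<longlonglongrightarrow> c * integral\<^sup>L L \<phi>"
        using LIMSEQ_subseq_LIMSEQ[OF c' q] by (intro tendsto_mult) (use lim \<phi> in \<open>auto simp: o_def weakly_converges_def\<close>)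
      then show "(\<lambda>n. integral\<^sup>L ((M \<circ> (r' \<circ> q)) n) \<phi>) \<longlonglongrightarrow> integral\<^sup>L (scale_measure (ennreal c) L) \<phi>"
        using borel_measurable_continuous_onI[OF \<phi>(1)] by (simp add: S(3) p(3))
    qed
  qed
qed

lemma pos_measure_compact_approx:
  fixes M :: "'a::euclidean_space measure"
  assumes M: "M \<in> pos_measures" and \<epsilon>: "\<epsilon> > 0"
  obtains K where "compact K" "measure M (UNIV - K) < \<epsilon>"
proof -
  note sM = pos_measuresD[OF M]
  interpret finite_measure M by (rule sM)
  have "(\<lambda>k. measure M (UNIV - cball 0 (real k))) \<longlonglongrightarrow> measure M (\<Inter>k. UNIV - cball 0 (real k))"
  proof (rule finite_Lim_measure_decseq)
    show "range (\<lambda>k. UNIV - cball (0 :: 'a) (real k)) \<subseteq> sets M" using sM by auto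
    show "decseq (\<lambda>k. UNIV - cball (0 :: 'a) (real k))"
      unfolding decseq_def by (intro allI impI Diff_mono subset_cball) auto
  qed
  also have "(\<Inter>k. UNIV - cball (0 :: 'a) (real k)) = {}"
  proof (intro equals0I)
    fix x :: 'a assume x: "x \<in> (\<Inter>k. UNIV - cball 0 (real k))"
    obtain k where "norm x \<le> real k" using real_arch_simple by blast
    moreover have "\<not> norm x \<le> real k" using x by simp
    ultimately show False by blast
  qed
  finally have "(\<lambda>k. measure M (UNIV - cball 0 (real k))) \<longlonglongrightarrow> 0" by simp
  from order_tendstoD(2)[OF this \<epsilon>]
  have "eventually (\<lambda>k. measure M (UNIV - cball 0 (real k)) < \<epsilon>) sequentially" .
  then obtain k where "measure M (UNIV - cball 0 (real k)) < \<epsilon>"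
    unfolding eventually_sequentially by blast
  with that[of "cball 0 (real k)"] show ?thesis by simp
qed

subsection \<open>Convergence in norm\<close>

text \<open>The sum of the \<open>\<phi> i\<close> lies between the indicator of \<open>K\<close>
  and 1.\<close>

lemma partition_of_unity_mass:
  fixes J :: "'a::euclidean_space measure" and m :: nat
  assumes J: "J \<in> pos_measures" and K: "K \<in> sets borel"
    and m: "\<And>i. \<phi> i \<in> borel_measurable borel" and nn: "\<And>i x. 0 \<le> \<phi> i x"
    and le1: "\<And>x. (\<Sum>i<m. \<phi> i x) \<le> 1" and eq1: "\<And>x. x \<in> K \<Longrightarrow> (\<Sum>i<m. \<phi> i x) = 1"
  shows "measure J UNIV - measure J (UNIV - K) \<le> (\<Sum>i<m. integral\<^sup>L J (\<phi> i))"
    "(\<Sum>i<m. integral\<^sup>L J (\<phi> i)) \<le> measure J UNIV"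
proof -
  note sJ = pos_measuresD[OF J]
  interpret finite_measure J by (rule sJ)
  have \<phi>1: "\<phi> i x \<le> 1" if "i < m" for i x
  proof (rule order_trans[OF _ le1])
    show "\<phi> i x \<le> (\<Sum>i<m. \<phi> i x)" using nn that by (intro member_le_sum) auto
  qed
  have int: "integrable J (\<phi> i)" if "i < m" for i
    using nn \<phi>1 that by (intro integrable_bounded_pos_measures[OF J m, of i 1]) auto
  have eq: "(\<integral>x. (\<Sum>i<m. \<phi> i x) \<partial>J) = (\<Sum>i<m. integral\<^sup>L J (\<phi> i))"
    using int by (intro Bochner_Integration.integral_sum) auto
  have ints: "integrable J (\<lambda>x. \<Sum>i<m. \<phi> i x)"
    using int by (intro Bochner_Integration.integrable_sum) auto
  have "measure J UNIV - measure J (UNIV - K) = measure J K"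
    using finite_measure_compl[of K] K sJ by simp
  also have "\<dots> = (\<integral>x. indicator K x \<partial>J)" using K sJ by simp
  also have "\<dots> \<le> (\<integral>x. (\<Sum>i<m. \<phi> i x) \<partial>J)"
    using K sJ ints nn
    by (intro integral_mono integrable_real_indicator)
      (auto simp: indicator_def eq1 emeasure_eq_measure intro: sum_nonneg)
  finally show "measure J UNIV - measure J (UNIV - K) \<le> (\<Sum>i<m. integral\<^sup>L J (\<phi> i))" by (simp add: eq)
  have "(\<integral>x. (\<Sum>i<m. \<phi> i x) \<partial>J) \<le> (\<integral>x. 1 \<partial>J)"
    using le1 ints by (intro integral_mono) auto
  then show "(\<Sum>i<m. integral\<^sup>L J (\<phi> i)) \<le> measure J UNIV" using sJ by (simp add: eq)
qed

text \<open>Error budget: either side leaves at most \<open>2 * \<eta>\<close> of its mass behind,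
  one \<open>\<eta>\<close> from the tail and one from the mismatch \<open>D n\<close>, costing
  \<open>4 * a * \<eta> = \<epsilon> / 2\<close> in all. Transport costs at most
  \<open>b * \<delta> * B = \<epsilon> / 4\<close>.\<close>

lemma norm_ab_tendsto_zeroI:
  fixes \<sigma> :: "nat \<Rightarrow> 'a::euclidean_space set \<Rightarrow> real"
  assumes ab: "a > 0" "b > 0" and \<sigma>: "\<And>n. \<sigma> n \<in> signed_measures"
    and t: "tight_signed \<sigma>" and A: "\<And>n. total_mass (\<sigma> n) \<le> A"
    and lim: "\<And>\<phi> L. L > 0 \<Longrightarrow> L-lipschitz_on UNIV \<phi> \<Longrightarrow> (\<And>x. \<bar>\<phi> x\<bar> \<le> 1) \<Longrightarrow>
      (\<lambda>n. signed_integral (\<sigma> n) \<phi>) \<longlonglongrightarrow> 0"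
  shows "(\<lambda>n. norm_ab a b (\<sigma> n)) \<longlonglongrightarrow> 0"
proof (rule LIMSEQ_I)
  fix \<epsilon> :: real assume \<epsilon>: "\<epsilon> > 0"
  \<comment> \<open>The maximum with 1 makes \<open>B\<close> positive, as the division in
    \<open>\<delta>\<close> requires.\<close>
  define B where "B = max A 1"
  define \<eta> where "\<eta> = \<epsilon> / (8 * a)"
  define \<delta> where "\<delta> = \<epsilon> / (4 * b * B)"
  have pos: "B > 0" "\<eta> > 0" "\<delta> > 0" using ab \<epsilon> by (auto simp: B_def \<eta>_def \<delta>_def)
  define J J' where "J n = pos_part (\<sigma> n)" and "J' n = neg_part (\<sigma> n)" for n
  have JJ: "J n \<in> pos_measures" "J' n \<in> pos_measures" for n
    unfolding J_def J'_def using decompositionD[OF decomposition_pos_neg_part[OF \<sigma>]] by auto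
  have mass: "measure (J n) UNIV \<le> B" for n
  proof -
    have "measure (J n) UNIV + measure (J' n) UNIV \<le> A"
      using A[of n] by (simp add: J_def J'_def total_mass_def)
    moreover have "A \<le> B" by (simp add: B_def)
    ultimately show ?thesis using measure_nonneg[of "J' n" UNIV] by linarith
  qed
  obtain K1 K2 where K1: "compact K1" "\<And>n. measure (J n) (UNIV - K1) < \<eta>"
    and K2: "compact K2" "\<And>n. measure (J' n) (UNIV - K2) < \<eta>"
    using t pos(2) unfolding tight_signed_def tight_pos_def J_def J'_def by blast
  define K where "K = K1 \<union> K2"
  have cK: "compact K" using K1 K2 by (simp add: K_def compact_Un)
  then have bK: "K \<in> sets borel" by (rule borel_compact)
  have mono: "measure M (UNIV - K) \<le> measure M (UNIV - K')"
    if "M \<in> pos_measures" "K' = K1 \<or> K' = K2" for M K'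
  proof -
    note sM = pos_measuresD[OF that(1)]
    interpret finite_measure M by (rule sM)
    show ?thesis using that(2) K1(1) K2(1) sM
      by (intro finite_measure_mono) (auto simp: K_def borel_compact)
  qed
  have tail: "measure (J n) (UNIV - K) < \<eta>" "measure (J' n) (UNIV - K) < \<eta>" for n
    using mono[OF JJ(1), of K1 n] mono[OF JJ(2), of K2 n] K1(2)[of n] K2(2)[of n] by auto
  obtain m :: nat and \<phi> :: "nat \<Rightarrow> 'a \<Rightarrow> real" where
    \<phi>L: "\<forall>i. \<exists>L>0. L-lipschitz_on UNIV (\<phi> i)" and "\<forall>i x. 0 \<le> \<phi> i x"
    "\<forall>x. (\<Sum>i<m. \<phi> i x) \<le> 1" "\<forall>x\<in>K. (\<Sum>i<m. \<phi> i x) = 1"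
    "\<forall>i x y. \<phi> i x \<noteq> 0 \<longrightarrow> \<phi> i y \<noteq> 0 \<longrightarrow> norm (x - y) \<le> \<delta>"
    by (rule lipschitz_partition_of_unity[OF cK pos(3)])
  then have \<phi>: "0 \<le> \<phi> i x" "(\<Sum>i<m. \<phi> i x) \<le> 1" "x \<in> K \<Longrightarrow> (\<Sum>i<m. \<phi> i x) = 1"
    "\<phi> i x \<noteq> 0 \<Longrightarrow> \<phi> i y \<noteq> 0 \<Longrightarrow> norm (x - y) \<le> \<delta>" for i x y by auto
  have \<phi>m: "\<phi> i \<in> borel_measurable borel" for i
    using \<phi>L lipschitz_on_borel_measurable by blast
  have \<phi>1: "\<bar>\<phi> i x\<bar> \<le> 1" if "i < m" for i x
  proof -
    have "\<phi> i x \<le> (\<Sum>i<m. \<phi> i x)" using \<phi>(1) that by (intro member_le_sum) auto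
    with \<phi>(1)[of i x] \<phi>(2)[of x] show ?thesis by linarith
  qed
  define D where "D n = (\<Sum>i<m. \<bar>signed_integral (\<sigma> n) (\<phi> i)\<bar>)" for n
  have "D \<longlonglongrightarrow> (\<Sum>i<m. \<bar>0\<bar>)"
    unfolding D_def
  proof (intro tendsto_sum tendsto_rabs)
    fix i assume "i \<in> {..<m}"
    moreover obtain L where "L > 0" "L-lipschitz_on UNIV (\<phi> i)" using \<phi>L by blast
    ultimately show "(\<lambda>n. signed_integral (\<sigma> n) (\<phi> i)) \<longlonglongrightarrow> 0" using \<phi>1 by (intro lim) auto
  qed
  then have "eventually (\<lambda>n. D n < \<eta>) sequentially"
    using order_tendstoD(2)[of D _ sequentially \<eta>] pos(2) by simp
  then obtain n0 where n0: "\<And>n. n \<ge> n0 \<Longrightarrow> D n < \<eta>" unfolding eventually_sequentially by blast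
  have "norm (norm_ab a b (\<sigma> n) - 0) < \<epsilon>" if "n \<ge> n0" for n
  proof -
    define p q where "p i = integral\<^sup>L (J n) (\<phi> i)" and "q i = integral\<^sup>L (J' n) (\<phi> i)" for i
    define s where "s = (\<Sum>i<m. min (p i) (q i))"
    have D: "D n = (\<Sum>i<m. \<bar>p i - q i\<bar>)"
      by (simp add: D_def signed_integral_def p_def q_def J_def J'_def)
    \<comment> \<open>Termwise, \<open>min (p i) (q i)\<close> is at least \<open>p i\<close> and at
      least \<open>q i\<close>, each less \<open>\<bar>p i - q i\<bar>\<close>.\<close>
    have "(\<Sum>i<m. p i) - D n \<le> s" "(\<Sum>i<m. q i) - D n \<le> s" "s \<le> (\<Sum>i<m. p i)"
      unfolding D s_def sum_subtractf[symmetric] by (auto intro!: sum_mono)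
    moreover note partition_of_unity_mass[OF JJ(1) bK \<phi>m \<phi>(1-3), of n, folded p_def]
      partition_of_unity_mass[OF JJ(2) bK \<phi>m \<phi>(1-3), of n, folded q_def]
    moreover note tail[of n] mass[of n] n0[OF that]
    ultimately have le: "measure (J n) UNIV - s \<le> 2 * \<eta>" "measure (J' n) UNIV - s \<le> 2 * \<eta>" "s \<le> B"
      by linarith+
    have "W1ab a b (J n) (J' n) \<le>
        ennreal (a * (measure (J n) UNIV - s + (measure (J' n) UNIV - s)) + b * (\<delta> * s))"
      by (rule W1ab_le_partition_of_unity[OF ab JJ \<phi>m \<phi>(1,2,4) less_imp_le[OF pos(3)]])
        (simp_all add: s_def p_def q_def)
    also have "\<dots> \<le> ennreal (a * (2 * \<eta> + 2 * \<eta>) + b * (\<delta> * B))"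
      using le ab pos by (intro ennreal_leI add_mono mult_left_mono) auto
    also have "a * (2 * \<eta> + 2 * \<eta>) + b * (\<delta> * B) = 3 / 4 * \<epsilon>"
      using ab pos(1) by (simp add: \<eta>_def \<delta>_def field_simps)
    finally have "enn2real (W1ab a b (J n) (J' n)) \<le> 3 / 4 * \<epsilon>"
      using \<epsilon> by (intro enn2real_leI) auto
    moreover have "norm_ab a b (\<sigma> n) \<le> enn2real (W1ab a b (J n) (J' n))"
      unfolding J_def J'_def by (rule norm_ab_le_jordan[OF \<sigma>])
    moreover have "0 \<le> norm_ab a b (\<sigma> n)"
      by (simp add: norm_ab_def Let_def case_prod_beta)
    ultimately show ?thesis using \<epsilon> by simp
  qed
  then show "\<exists>n0. \<forall>n\<ge>n0. norm (norm_ab a b (\<sigma> n) - 0) < \<epsilon>" by blast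
qed

section \<open>Mass and tightness of differences; identification of the limit\<close>

lemma total_mass_diff_le:
  assumes "\<mu> \<in> signed_measures" "\<nu> \<in> signed_measures"
  shows "total_mass (\<mu> - \<nu>) \<le> total_mass \<mu> + total_mass \<nu>"
proof -
  note d = decomposition_pos_neg_part[OF assms(1)] decomposition_pos_neg_part[OF assms(2)]
  show ?thesis
    using total_mass_le[OF decomposition_diff[OF d]] decompositionD[OF d(1)] decompositionD[OF d(2)]
    by (simp add: measure_add_measure total_mass_def)
qed

text \<open>Setwise domination transfers tail bounds, and the single finite measure \<open>N\<close>
  is tight by itself; each contributes \<open>\<epsilon> / 2\<close> outside the union of the two
  compact sets.\<close>

lemma tight_pos_dominated:
  fixes M :: "nat \<Rightarrow> 'a::euclidean_space measure"
  assumes t: "tight_pos M" and M: "\<And>n. M n \<in> pos_measures" and N: "N \<in> pos_measures"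
    and le: "\<And>n A. A \<in> sets borel \<Longrightarrow> measure (J n) A \<le> measure (M n) A + measure N A"
  shows "tight_pos J"
  unfolding tight_pos_def
proof (intro allI impI)
  fix \<epsilon> :: real assume "\<epsilon> > 0"
  then have \<epsilon>: "\<epsilon> / 2 > 0" by simp
  obtain K1 where K1: "compact K1" "\<And>n. measure (M n) (UNIV - K1) < \<epsilon> / 2"
    using t \<epsilon> unfolding tight_pos_def by blast
  obtain K2 where K2: "compact K2" "measure N (UNIV - K2) < \<epsilon> / 2"
    using pos_measure_compact_approx[OF N \<epsilon>] .
  have mono: "measure P (UNIV - (K1 \<union> K2)) \<le> measure P (UNIV - K')"
    if "P \<in> pos_measures" "K' = K1 \<or> K' = K2" for P K'
  proof -
    note sP = pos_measuresD[OF that(1)]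
    interpret finite_measure P by (rule sP)
    show ?thesis using that(2) K1(1) K2(1) sP
      by (intro finite_measure_mono) (auto simp: borel_compact)
  qed
  have "measure (J n) (UNIV - (K1 \<union> K2)) < \<epsilon>" for n
  proof -
    have "UNIV - (K1 \<union> K2) \<in> sets borel" using sets.compl_sets[OF borel_compact[OF compact_Un[OF K1(1) K2(1)]]] by simp
    from le[OF this, of n] mono[OF M, of K1 n] mono[OF N, of K2] K1(2)[of n] K2(2)
    show ?thesis by simp
  qed
  with K1 K2 show "\<exists>K. compact K \<and> (\<forall>n. measure (J n) (UNIV - K) < \<epsilon>)"
    by (intro exI[of _ "K1 \<union> K2"]) (auto intro: compact_Un)
qed

text \<open>By minimality the Jordan parts of \<open>\<mu> n - \<nu>\<close> lie below the crossed
  sums of the parts of \<open>\<mu> n\<close> and \<open>\<nu>\<close>.\<close>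

lemma tight_signed_diff:
  fixes \<nu> :: "'a::euclidean_space set \<Rightarrow> real"
  assumes t: "tight_signed \<mu>" and \<mu>: "\<And>n. \<mu> n \<in> signed_measures" and \<nu>: "\<nu> \<in> signed_measures"
  shows "tight_signed (\<lambda>n. \<mu> n - \<nu>)"
proof -
  note d = decomposition_pos_neg_part[OF \<mu>] decomposition_pos_neg_part[OF \<nu>]
  note p = decompositionD(1,2)[OF d(1)] decompositionD(1,2)[OF d(2)]
  note le = pos_neg_part_le[OF decomposition_diff[OF d]]
  have t: "tight_pos (\<lambda>n. pos_part (\<mu> n))" "tight_pos (\<lambda>n. neg_part (\<mu> n))"
    using t by (simp_all add: tight_signed_def)
  show ?thesis
    unfolding tight_signed_def
  proof
    show "tight_pos (\<lambda>n. pos_part (\<mu> n - \<nu>))"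
    proof (rule tight_pos_dominated[OF t(1) p(1) p(4)])
      fix n and A :: "'a set" assume "A \<in> sets borel"
      from le(1)[OF this, of n]
      show "measure (pos_part (\<mu> n - \<nu>)) A \<le> measure (pos_part (\<mu> n)) A + measure (neg_part \<nu>) A"
        by (simp only: measure_add_measure[OF p(1) p(4)])
    qed
    show "tight_pos (\<lambda>n. neg_part (\<mu> n - \<nu>))"
    proof (rule tight_pos_dominated[OF t(2) p(2) p(3)])
      fix n and A :: "'a set" assume "A \<in> sets borel"
      from le(2)[OF this, of n]
      show "measure (neg_part (\<mu> n - \<nu>)) A \<le> measure (neg_part (\<mu> n)) A + measure (pos_part \<nu>) A"
        by (simp only: measure_add_measure[OF p(2) p(3)])
    qed
  qed
qed

lemma weakly_converges_subseq:
  assumes "weakly_converges M L" "strict_mono r"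
  shows "weakly_converges (M \<circ> r) L"
  unfolding weakly_converges_def
proof (intro allI impI)
  fix \<phi> :: "'a \<Rightarrow> real" and B assume "continuous_on UNIV \<phi>" "\<forall>x. \<bar>\<phi> x\<bar> \<le> B"
  then have "(\<lambda>n. integral\<^sup>L (M n) \<phi>) \<longlonglongrightarrow> integral\<^sup>L L \<phi>"
    using assms(1) by (auto simp: weakly_converges_def)
  from LIMSEQ_subseq_LIMSEQ[OF this assms(2)]
  show "(\<lambda>n. integral\<^sup>L ((M \<circ> r) n) \<phi>) \<longlonglongrightarrow> integral\<^sup>L L \<phi>" by (simp add: o_def)
qed

lemma tight_pos_subseq: "tight_pos M \<Longrightarrow> tight_pos (M \<circ> r)"
  unfolding tight_pos_def comp_def by meson

theorem theorem29:
  fixes a b :: real and \<mu> :: "nat \<Rightarrow> 'a::euclidean_space set \<Rightarrow> real"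
  assumes "a > 0" and "b > 0"
    and "\<And>n. \<mu> n \<in> signed_measures"
    and cauchy: "\<forall>\<epsilon>>0. \<exists>n0. \<forall>m\<ge>n0. \<forall>n\<ge>n0. norm_ab a b (\<mu> m - \<mu> n) < \<epsilon>"
    and tight: "tight_signed \<mu>"
    and bounded: "\<exists>C. \<forall>n. total_mass (\<mu> n) \<le> C"
  shows "\<exists>\<nu>\<in>signed_measures. (\<lambda>n. norm_ab a b (\<mu> n - \<nu>)) \<longlonglongrightarrow> 0"
proof -
  define P N where "P n = pos_part (\<mu> n)" and "N n = neg_part (\<mu> n)" for n
  obtain C where C: "\<And>n. total_mass (\<mu> n) \<le> C" using bounded by blast
  have PN: "P n \<in> pos_measures" "N n \<in> pos_measures" for n
    unfolding P_def N_def using decompositionD[OF decomposition_pos_neg_part[OF assms(3)]] by auto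
  have mass: "measure (P n) UNIV \<le> C" "measure (N n) UNIV \<le> C" for n
  proof -
    have "measure (P n) UNIV + measure (N n) UNIV \<le> C"
      using C[of n] by (simp add: total_mass_def P_def N_def)
    then show "measure (P n) UNIV \<le> C" "measure (N n) UNIV \<le> C"
      using measure_nonneg[of "N n" UNIV] measure_nonneg[of "P n" UNIV] by linarith+
  qed
  have tPN: "tight_pos P" "tight_pos N" using tight by (simp_all add: tight_signed_def P_def[abs_def] N_def[abs_def])
  obtain r1 P' where r1: "strict_mono r1" and P': "P' \<in> pos_measures" "weakly_converges (P \<circ> r1) P'"
    by (rule tight_convergent_subsequence[OF PN(1) mass(1) tPN(1)])
  \<comment> \<open>Extracted from \<open>N\<close> along \<open>r1\<close>, so that both families
    converge along \<open>r1 \<circ> r2\<close>.\<close>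
  obtain r2 N' where r2: "strict_mono r2" and N': "N' \<in> pos_measures" "weakly_converges (N \<circ> r1 \<circ> r2) N'"
    by (rule tight_convergent_subsequence[of "N \<circ> r1" C]) (auto simp: PN mass tPN tight_pos_subseq)
  define r where "r = r1 \<circ> r2"
  have r: "strict_mono r" unfolding r_def by (rule strict_mono_o[OF r1 r2])
  have wP: "weakly_converges (P \<circ> r) P'" and wN: "weakly_converges (N \<circ> r) N'"
    using weakly_converges_subseq[OF P'(2) r2] N'(2) by (simp_all add: r_def o_assoc)
  define \<nu> where "\<nu> = measure P' - measure N'"
  have d: "decomposition \<nu> P' N'" unfolding \<nu>_def by (rule measure_diff_decomposition[OF P'(1) N'(1)])
  then have \<nu>: "\<nu> \<in> signed_measures" by (rule decomposition_imp_signed)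
  have "(\<lambda>n. norm_ab a b (\<mu> n - \<nu>)) \<longlonglongrightarrow> 0"
  proof (rule norm_ab_tendsto_zeroI[OF assms(1,2)])
    show "\<mu> n - \<nu> \<in> signed_measures" for n by (rule signed_measures_diff[OF assms(3) \<nu>])
    show "tight_signed (\<lambda>n. \<mu> n - \<nu>)" by (rule tight_signed_diff[OF tight assms(3) \<nu>])
    show "total_mass (\<mu> n - \<nu>) \<le> C + total_mass \<nu>" for n
      using total_mass_diff_le[OF assms(3) \<nu>, of n] C[of n] by linarith
  next
    fix \<phi> :: "'a \<Rightarrow> real" and L
    assume L: "L > 0" "L-lipschitz_on UNIV \<phi>" and \<phi>: "\<And>x. \<bar>\<phi> x\<bar> \<le> 1"
    have c: "continuous_on UNIV \<phi>" by (rule lipschitz_on_continuous_on[OF L(2)])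
    have m: "\<phi> \<in> borel_measurable borel" by (rule lipschitz_on_borel_measurable[OF L(2)])
    define I where "I n = signed_integral (\<mu> n) \<phi>" for n
    have "(\<lambda>n. integral\<^sup>L ((P \<circ> r) n) \<phi> - integral\<^sup>L ((N \<circ> r) n) \<phi>) \<longlonglongrightarrow> integral\<^sup>L P' \<phi> - integral\<^sup>L N' \<phi>"
      using wP wN c \<phi> unfolding weakly_converges_def by (intro tendsto_diff) blast+
    then have sub: "(I \<circ> r) \<longlonglongrightarrow> signed_integral \<nu> \<phi>"
      unfolding signed_integral_decomposition[OF d m \<phi>]
      by (simp add: I_def o_def signed_integral_def P_def N_def)
    have "Cauchy I"
    proof (rule metric_CauchyI)
      fix e :: real assume e: "e > 0"
      \<comment> \<open>The constant of \<open>abs_signed_integral_le_norm_ab\<close> for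
        \<open>B = 1\<close>.\<close>
      define \<kappa> where "\<kappa> = 1 / a + L / b"
      have \<kappa>: "\<kappa> > 0" using assms(1,2) L(1) by (simp add: \<kappa>_def add_pos_pos)
      then obtain n0 where n0: "\<forall>m\<ge>n0. \<forall>n\<ge>n0. norm_ab a b (\<mu> m - \<mu> n) < e / \<kappa>"
        using cauchy e by (meson divide_pos_pos)
      have "dist (I m) (I n) < e" if "m \<ge> n0" "n \<ge> n0" for m n
      proof -
        have "dist (I m) (I n) = \<bar>signed_integral (\<mu> m - \<mu> n) \<phi>\<bar>"
          by (simp add: signed_integral_diff[OF assms(3) assms(3) \<open>\<phi> \<in> borel_measurable borel\<close> \<phi>] I_def dist_real_def)
        also have "\<dots> \<le> \<kappa> * norm_ab a b (\<mu> m - \<mu> n)"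
          unfolding \<kappa>_def
          by (rule abs_signed_integral_le_norm_ab[OF assms(1,2) signed_measures_diff[OF assms(3) assms(3)] L(2,1) \<phi>])
        also have "\<dots> < \<kappa> * (e / \<kappa>)" using n0 that \<kappa> by (intro mult_strict_left_mono) auto
        finally show ?thesis using \<kappa> by simp
      qed
      then show "\<exists>n0. \<forall>m\<ge>n0. \<forall>n\<ge>n0. dist (I m) (I n) < e" by blast
    qed
    \<comment> \<open>A Cauchy sequence takes on the limit of its subsequence; \<open>\<nu>\<close>
      does not depend on \<open>\<phi>\<close>, so one limit measure serves all tests.\<close>
    from Cauchy_converges_subseq[OF this r sub] have "I \<longlonglongrightarrow> signed_integral \<nu> \<phi>" .
    then have "(\<lambda>n. I n - signed_integral \<nu> \<phi>) \<longlonglongrightarrow> 0" by (simp add: LIM_zero_iff)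
    then show "(\<lambda>n. signed_integral (\<mu> n - \<nu>) \<phi>) \<longlonglongrightarrow> 0"
      by (simp add: signed_integral_diff[OF assms(3) \<nu> m \<phi>] I_def)
  qed
  with \<nu> show ?thesis by blast
qed

end
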